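(* Let $s\in(0,1)$, $N>2s$, $0<q<1$, and let $\Omega\subset\mathbb{R}^N$ be a bounded domain with boundary of class $C^{1,1}$. For $\lambda>0$ consider the problem $$(P_\lambda^0)\qquad (-\Delta)^s u=\lambda(u^q-1)\ \text{ in }\Omega,\qquad u>0\ \text{ in }\Omega,\qquad u\equiv 0\ \text{ on }\mathbb{R}^N\setminus\Omega .$$ There exists $\lambda_0\in(0,\infty)$ such that for all $\lambda>\lambda_0$ the problem $(P_\lambda^0)$ admits at least one positive (weak) solution, and $(P_{\lambda_0}^0)$ admits a non-negative (weak) solution, i.e. a weak solution in which the requirement $u>0$ in $\Omega$ is replaced by $u\ge 0$ in $\Omega$.
   Context: Notation: $C_{N,s}=\pi^{-N/2}2^{2s-1}\Gamma\left(\frac{N+2s}{2}\right)/\Gamma(1-s)$ and $(-\Delta)^s u(x)=2C_{N,s}\,\mathrm{P.V.}\int_{\mathbb{R}^N}\frac{u(x)-u(y)}{|x-y|^{N+2s}}\,dy$. Put $\Omega^c=\mathbb{R}^N\setminus\Omega$ and $Q=\mathbb{R}^N\times\mathbb{R}^N\setminus(\Omega^c\times\Omega^c)$. The space $X^s(\Omega)$ consists of all Lebesgue measurable $u:\mathbb{R}^N\to\mathbb{R}$ with $u|_\Omega\in L^2(\Omega)$ and $\int_Q\frac{|u(x)-u(y)|^2}{|x-y|^{N+2s}}\,dx\,dy<\infty$, and $X_0^s(\Omega)=\{u\in X^s(\Omega):u=0\text{ a.e. in }\Omega^c\}$. A weak solution of $(P_\lambda^0)$ is a function $u\in X_0^s(\Omega)$,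 satisfying the sign condition in $\Omega$, such that for all $\varphi\in C_c^\infty(\Omega)$ $$C_{N,s}\int_Q\frac{(u(x)-u(y))(\varphi(x)-\varphi(y))}{|x-y|^{N+2s}}\,dx\,dy=\lambda\int_\Omega(u^q-1)\varphi\,dx .$$ *)

theory Defs
  imports "HOL-Analysis.Analysis"
begin

text \<open>Euclidean space of dimension \<open>N\<close> is any type of class \<open>euclidean_space\<close>, with
  \<open>N = DIM('a)\<close>.\<close>

definition C11_function :: "('a::euclidean_space \<Rightarrow> real) \<Rightarrow> bool" where
  "C11_function g \<longleftrightarrow>
     (\<exists>G::'a \<Rightarrow> 'a. (\<forall>x. (g has_derivative (\<lambda>h. G x \<bullet> h)) (at x)) \<and> (\<exists>L. L-lipschitz_on UNIV G))"

text \<open>Near every boundary point the set is, up to an orthogonal change of coordinates, the strict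
  epigraph of a \<open>C\<^sup>1\<^sup>,\<^sup>1\<close> function of \<open>N - 1\<close> variables. The unit vector \<open>e\<close> is the direction of the
  last coordinate and \<open>x - (x \<bullet> e) *\<^sub>R e\<close> is the projection of \<open>x\<close> to the orthogonal complement of
  \<open>e\<close>. Only the values of \<open>g\<close> on that hyperplane are used; a \<open>C\<^sup>1\<^sup>,\<^sup>1\<close> function on the hyperplane
  extends to the whole space by composing it with the projection. For \<open>N = 1\<close> the hyperplane is a
  point and the condition says that the set is a half-line near each boundary point.\<close>

definition C11_boundary :: "'a::euclidean_space set \<Rightarrow> bool" where
  "C11_boundary \<Omega> \<longleftrightarrow>
     (\<forall>p\<in>frontier \<Omega>. \<exists>r>0. \<exists>e g. norm e = 1 \<and> C11_function g \<and>
        \<Omega> \<inter> ball p r = {x \<in> ball p r. x \<bullet> e > g (x - (x \<bullet> e) *\<^sub>R e)})"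

definition bounded_C11_domain :: "'a::euclidean_space set \<Rightarrow> bool" where
  "bounded_C11_domain \<Omega> \<longleftrightarrow>
     open \<Omega> \<and> connected \<Omega> \<and> \<Omega> \<noteq> {} \<and> bounded \<Omega> \<and> C11_boundary \<Omega>"

primrec times_differentiable :: "nat \<Rightarrow> ('a::euclidean_space \<Rightarrow> real) \<Rightarrow> bool" where
  "times_differentiable 0 f \<longleftrightarrow> continuous_on UNIV f"
| "times_differentiable (Suc k) f \<longleftrightarrow>
     (\<forall>x. f differentiable (at x)) \<and>
     (\<forall>v. times_differentiable k (\<lambda>x. frechet_derivative f (at x) v))"

text \<open>The space \<open>C\<^sub>c\<^sup>\<infinity>(\<Omega>)\<close>, each function being extended by zero to the whole space.\<close>

definition test_functions :: "'a::euclidean_space set \<Rightarrow> ('a \<Rightarrow> real) set" where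
  "test_functions \<Omega> =
     {\<phi>. (\<forall>k. times_differentiable k \<phi>) \<and>
         compact (closure {x. \<phi> x \<noteq> 0}) \<and> closure {x. \<phi> x \<noteq> 0} \<subseteq> \<Omega>}"

definition frac_const :: "nat \<Rightarrow> real \<Rightarrow> real" where
  "frac_const N s =
     pi powr (- real N / 2) * 2 powr (2 * s - 1) * Gamma ((real N + 2 * s) / 2) / Gamma (1 - s)"

definition Q_set :: "'a set \<Rightarrow> ('a \<times> 'a) set" where
  "Q_set \<Omega> = UNIV - (- \<Omega>) \<times> (- \<Omega>)"

text \<open>On the diagonal, a null set of the product space, the quotients below are \<open>0 / 0 = 0\<close>.\<close>

definition Xs :: "real \<Rightarrow> 'a::euclidean_space set \<Rightarrow> ('a \<Rightarrow> real) set" where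
  "Xs s \<Omega> =
     {u. u \<in> borel_measurable lebesgue \<and>
         set_integrable lebesgue \<Omega> (\<lambda>x. (u x)\<^sup>2) \<and>
         set_integrable lebesgue (Q_set \<Omega>)
           (\<lambda>(x, y). \<bar>u x - u y\<bar>\<^sup>2 / norm (x - y) powr (real DIM('a) + 2 * s))}"

definition Xs0 :: "real \<Rightarrow> 'a::euclidean_space set \<Rightarrow> ('a \<Rightarrow> real) set" where
  "Xs0 s \<Omega> = {u \<in> Xs s \<Omega>. AE x in lebesgue. x \<in> - \<Omega> \<longrightarrow> u x = 0}"

definition energy_form ::
    "real \<Rightarrow> 'a::euclidean_space set \<Rightarrow> ('a \<Rightarrow> real) \<Rightarrow> ('a \<Rightarrow> real) \<Rightarrow> real" where
  "energy_form s \<Omega> u \<phi> =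
     frac_const DIM('a) s *
     set_lebesgue_integral lebesgue (Q_set \<Omega>)
       (\<lambda>(x, y). (u x - u y) * (\<phi> x - \<phi> y) / norm (x - y) powr (real DIM('a) + 2 * s))"

text \<open>The weak formulation without the sign condition; it is only used for \<open>u \<ge> 0\<close> in \<open>\<Omega>\<close>, where
  \<open>u x powr q\<close> is the real power (with \<open>0 powr q = 0\<close>). For \<open>u \<in> Xs0 s \<Omega>\<close> and \<open>\<Omega>\<close> bounded, both
  integrands are integrable, so neither Bochner integral takes its default value.\<close>

definition satisfies_weak_form ::
    "real \<Rightarrow> real \<Rightarrow> real \<Rightarrow> 'a::euclidean_space set \<Rightarrow> ('a \<Rightarrow> real) \<Rightarrow> bool" where
  "satisfies_weak_form s q lam \<Omega> u \<longleftrightarrow>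
     (\<forall>\<phi>\<in>test_functions \<Omega>.
        energy_form s \<Omega> u \<phi> = lam * (LINT x:\<Omega>|lebesgue. (u x powr q - 1) * \<phi> x))"

definition positive_weak_solution ::
    "real \<Rightarrow> real \<Rightarrow> real \<Rightarrow> 'a::euclidean_space set \<Rightarrow> ('a \<Rightarrow> real) \<Rightarrow> bool" where
  "positive_weak_solution s q lam \<Omega> u \<longleftrightarrow>
     u \<in> Xs0 s \<Omega> \<and> (\<forall>x\<in>\<Omega>. u x > 0) \<and> satisfies_weak_form s q lam \<Omega> u"

definition nonnegative_weak_solution ::
    "real \<Rightarrow> real \<Rightarrow> real \<Rightarrow> 'a::euclidean_space set \<Rightarrow> ('a \<Rightarrow> real) \<Rightarrow> bool" where
  "nonnegative_weak_solution s q lam \<Omega> u \<longleftrightarrow>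
     u \<in> Xs0 s \<Omega> \<and> (\<forall>x\<in>\<Omega>. u x \<ge> 0) \<and> satisfies_weak_form s q lam \<Omega> u"

end

theory Submission
  imports Defs
begin

text \<open>The fractional Laplacian is nonlocal: at a point where a nonnegative, nontrivial function \<open>v\<close>
  vanishes it is strictly negative. Take \<open>v\<close> positive exactly on \<open>\<Omega>\<close> and semiconvex, so that its
  fractional Laplacian is bounded above by a constant \<open>C\<close> in \<open>\<Omega>\<close> and by some \<open>- c < 0\<close> where \<open>v \<le> \<delta>\<close>.
  Then a multiple of \<open>v\<close> of order \<open>\<lambda>\<close> is a subsolution for all large \<open>\<lambda>\<close>: near the boundary the
  right-hand side is at least \<open>- \<lambda>\<close>, and in the interior \<open>u\<^sup>q\<close> is large. Monotone iteration of the
  linear problem, solved by Riesz representation, starts from this subsolution. Its iterates increase,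
  their energies are bounded because \<open>q < 1\<close>, and so they converge in energy to a solution above the
  subsolution. Since every \<open>\<lambda> \<ge> \<Lambda>\<close> is covered, \<open>\<lambda>\<^sub>0 = \<Lambda>\<close> works.\<close>

subsection \<open>The kernel\<close>

text \<open>The right-hand side is negative where \<open>u\<close> vanishes, so zero is not a
  subsolution and solving the equation gives no sign for free; positivity has to be forced from
  below by a positive barrier. Its inequality must hold up to the boundary. A one-sided bound on
  second differences suffices: it controls the integral near \<open>h = 0\<close>, while the mass of
  \<open>v\<close> at a fixed distance supplies the negative sign. The constants
  \<open>\<delta>\<close>, \<open>c\<close>, \<open>C\<close> do not depend on \<lambda>:
  multiplying \<open>v\<close> by \<open>l / (a * c)\<close> turns \<open>- c\<close> into exactly
  \<open>- l\<close>, and where \<open>v > \<delta>\<close> only a lower bound on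
  \<open>u powr q\<close> remains, which holds for large \<open>l\<close>. The limit passage uses no
  compact embedding: the equations of two iterates are subtracted and tested with the difference of
  the iterates, and monotonicity bounds the result by a quantity that tends to zero by dominated
  convergence. Order relations are kept at every point, not only almost everywhere, because
  \<open>positive_weak_solution\<close> asks for \<open>u x > 0\<close> at each point of
  \<Omega>.\<close>

definition frac_kernel :: "real \<Rightarrow> 'a::euclidean_space \<Rightarrow> real" where
  "frac_kernel s h = 1 / norm h powr (real DIM('a) + 2 * s)"

lemma frac_kernel_nonneg [simp]: "0 \<le> frac_kernel s h"
  by (simp add: frac_kernel_def)

lemma frac_kernel_zero [simp]: "frac_kernel s 0 = 0"
  by (simp add: frac_kernel_def)

lemma frac_kernel_minus [simp]: "frac_kernel s (- h) = frac_kernel s h"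
  by (simp add: frac_kernel_def)

lemma frac_kernel_commute: "frac_kernel s (x - y) = frac_kernel s (y - x)"
  by (simp add: frac_kernel_def norm_minus_commute)

lemma frac_kernel_measurable [measurable]: "frac_kernel s \<in> borel_measurable borel"
  unfolding frac_kernel_def by measurable

lemma frac_kernel_antimono:
  fixes h :: "'a::euclidean_space"
  assumes "0 < s" "0 < r" "r \<le> norm h"
  shows "frac_kernel s h \<le> r powr - (real DIM('a) + 2 * s)"
proof -
  have "r powr (real DIM('a) + 2 * s) \<le> norm h powr (real DIM('a) + 2 * s)"
    using assms by (intro powr_mono2) auto
  moreover have "0 < r powr (real DIM('a) + 2 * s)"
    using assms by simp
  ultimately show ?thesis
    unfolding frac_kernel_def powr_minus_divide by (intro divide_left_mono mult_pos_pos) auto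
qed

text \<open>On the annulus the kernel is at most its value at radius \<open>r\<close>, and the
  annulus lies in a ball of radius \<open>2 * r\<close>. The volume factor
  \<open>r ^ DIM('a)\<close> cancels the dimensional part of the exponent and leaves
  \<open>r powr (- 2 * s)\<close>.\<close>

lemma frac_kernel_annulus:
  fixes r :: real
  assumes "0 < s" "0 < r"
  shows "emeasure (density lborel (\<lambda>h::'a::euclidean_space. min 1 ((norm h)\<^sup>2) * frac_kernel s h))
           {h. r \<le> norm h \<and> norm h < 2 * r}
         \<le> ennreal (min 1 (4 * r\<^sup>2) * (2 ^ DIM('a) * measure lborel (ball (0::'a) 1)) * r powr (- 2 * s))"
proof -
  let ?A = "{h::'a. r \<le> norm h \<and> norm h < 2 * r}"
  let ?c = "min 1 (4 * r\<^sup>2) * r powr - (real DIM('a) + 2 * s)"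
  have meas: "?A \<in> sets borel" by measurable
  have "emeasure (density lborel (\<lambda>h::'a. min 1 ((norm h)\<^sup>2) * frac_kernel s h)) ?A
      = (\<integral>\<^sup>+ h. ennreal (min 1 ((norm h)\<^sup>2) * frac_kernel s h) * indicator ?A h \<partial>lborel)"
    by (subst emeasure_density) (use meas in auto)
  also have "\<dots> \<le> (\<integral>\<^sup>+ h. ennreal ?c * indicator (ball (0::'a) (2 * r)) h \<partial>lborel)"
  proof (rule nn_integral_mono)
    fix h :: 'a
    show "ennreal (min 1 ((norm h)\<^sup>2) * frac_kernel s h) * indicator ?A h
        \<le> ennreal ?c * indicator (ball 0 (2 * r)) h"
    proof (cases "h \<in> ?A")
      case True
      then have "(norm h)\<^sup>2 \<le> (2 * r)\<^sup>2" by (intro power_mono) auto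
      then have "min 1 ((norm h)\<^sup>2) \<le> min 1 (4 * r\<^sup>2)" by (auto simp: power_mult_distrib)
      moreover have "frac_kernel s h \<le> r powr - (real DIM('a) + 2 * s)"
        using True assms by (intro frac_kernel_antimono) auto
      ultimately show ?thesis
        using True by (auto intro!: ennreal_leI mult_mono)
    qed auto
  qed
  also have "\<dots> = ennreal ?c * ennreal (measure lborel (ball (0::'a) (2 * r)))"
    using emeasure_lborel_ball_finite[of "0::'a" "2 * r"]
    by (simp add: nn_integral_cmult_indicator emeasure_eq_ennreal_measure)
  also have "\<dots> = ennreal (?c * measure lborel (ball (0::'a) (2 * r)))"
    by (rule ennreal_mult[symmetric]) auto
  also have "?c * measure lborel (ball (0::'a) (2 * r))
      = min 1 (4 * r\<^sup>2) * (2 ^ DIM('a) * measure lborel (ball (0::'a) 1)) * (r ^ DIM('a) * r powr - (real DIM('a) + 2 * s))"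
    using assms by (simp add: content_ball_conv_unit_ball[of "2 * r"] power_mult_distrib)
  also have "r ^ DIM('a) * r powr - (real DIM('a) + 2 * s) = r powr (- 2 * s)"
    using assms by (simp add: powr_realpow[symmetric] powr_add[symmetric])
  finally show ?thesis .
qed

text \<open>Dyadic decomposition into annuli of radii \<open>2 powr j\<close> and
  \<open>2 powr - j\<close>. The outer masses decay geometrically because \<open>s > 0\<close>, the
  inner ones because the factor \<open>(norm h)\<^sup>2\<close> beats the singularity for
  \<open>s < 1\<close>.\<close>

lemma integrable_frac_kernel:
  assumes "0 < s" "s < 1"
  shows "integrable lborel (\<lambda>h::'a::euclidean_space. min 1 ((norm h)\<^sup>2) * frac_kernel s h)"
proof -
  let ?f = "\<lambda>h::'a. min 1 ((norm h)\<^sup>2) * frac_kernel s h"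
  let ?\<nu> = "density lborel (\<lambda>h. ennreal (?f h))"
  define c where "c = 2 ^ DIM('a) * measure lborel (ball (0::'a) 1)"
  have c: "0 \<le> c" by (simp add: c_def)
  define A where "A r = {h::'a. r \<le> norm h \<and> norm h < 2 * r}" for r
  define F where "F j = A (2 powr real j) \<union> A (2 powr - real j)" for j :: nat
  have [measurable]: "A r \<in> sets borel" for r unfolding A_def by measurable
  \<comment> \<open>The outer annulus uses \<open>min 1 (4 * r\<^sup>2) \<le> 1\<close>, the inner
    one \<open>min 1 (4 * r\<^sup>2) \<le> 4 * r\<^sup>2\<close>; this gives the two ratios.\<close>
  define b where "b j = c * (2 powr (- 2 * s)) ^ j + 4 * c * (2 powr (2 * s - 2)) ^ j" for j :: nat
  have b: "0 \<le> b j" for j using c by (simp add: b_def)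
  have ann: "emeasure ?\<nu> (A r) \<le> ennreal (min 1 (4 * r\<^sup>2) * c * r powr (- 2 * s))" if "0 < r" for r
    unfolding A_def c_def using frac_kernel_annulus[OF assms(1) that, where 'a='a] by simp
  have F_le: "emeasure ?\<nu> (F j) \<le> ennreal (b j)" for j
  proof -
    have "emeasure ?\<nu> (A (2 powr real j)) \<le> ennreal (c * (2 powr (- 2 * s)) ^ j)"
    proof -
      have "(2 powr real j) powr (- 2 * s) = (2 powr (- 2 * s)) ^ j"
        by (simp add: powr_powr powr_realpow[symmetric] mult.commute)
      then have "min 1 (4 * (2 powr real j)\<^sup>2) * c * (2 powr real j) powr (- 2 * s) \<le> 1 * c * (2 powr (- 2 * s)) ^ j"
        using c by (intro mult_mono) auto
      then show ?thesis using ann[of "2 powr real j"] by (auto intro: order_trans ennreal_leI)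
    qed
    moreover have "emeasure ?\<nu> (A (2 powr - real j)) \<le> ennreal (4 * c * (2 powr (2 * s - 2)) ^ j)"
    proof -
      have "(2 powr - real j)\<^sup>2 * (2 powr - real j) powr (- 2 * s) = (2 powr (2 * s - 2)) ^ j"
        by (simp add: powr_powr powr_realpow[symmetric] powr_add[symmetric] algebra_simps)
      then have "(4 * (2 powr - real j)\<^sup>2) * c * (2 powr - real j) powr (- 2 * s) = 4 * c * (2 powr (2 * s - 2)) ^ j"
        by (simp add: algebra_simps)
      moreover have "min 1 (4 * (2 powr - real j)\<^sup>2) * c * (2 powr - real j) powr (- 2 * s) \<le> (4 * (2 powr - real j)\<^sup>2) * c * (2 powr - real j) powr (- 2 * s)"
        using c by (intro mult_right_mono) auto
      ultimately have "min 1 (4 * (2 powr - real j)\<^sup>2) * c * (2 powr - real j) powr (- 2 * s) \<le> 4 * c * (2 powr (2 * s - 2)) ^ j"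
        by linarith
      then show ?thesis using ann[of "2 powr - real j"] by (auto intro: order_trans ennreal_leI)
    qed
    ultimately have "emeasure ?\<nu> (A (2 powr real j)) + emeasure ?\<nu> (A (2 powr - real j))
        \<le> ennreal (c * (2 powr (- 2 * s)) ^ j) + ennreal (4 * c * (2 powr (2 * s - 2)) ^ j)"
      by (rule add_mono)
    also have "\<dots> = ennreal (b j)"
      unfolding b_def using c by (intro ennreal_plus[symmetric]) auto
    finally show ?thesis
      unfolding F_def by (intro order_trans[OF emeasure_subadditive]) auto
  qed
  have cover: "UNIV - {0} \<subseteq> (\<Union>j. F j)"
  proof
    fix h :: 'a assume "h \<in> UNIV - {0}"
    then have h: "0 < norm h" by simp
    define i where "i = \<lfloor>log 2 (norm h)\<rfloor>"
    have "2 powr real_of_int i \<le> norm h" "norm h < 2 powr (real_of_int i + 1)"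
      using h le_log_iff[of 2 "norm h" "real_of_int i"] log_less_iff[of 2 "norm h" "real_of_int i + 1"]
      unfolding i_def by auto
    then have "h \<in> A (2 powr real_of_int i)"
      using h by (simp add: A_def powr_add)
    moreover have "real_of_int i = real (nat i) \<or> real_of_int i = - real (nat (- i))"
      by (cases "0 \<le> i") auto
    ultimately have "h \<in> F (nat i) \<or> h \<in> F (nat (- i))"
      unfolding F_def by (metis UnI1 UnI2)
    then show "h \<in> (\<Union>j. F j)" by blast
  qed
  have sb: "summable b"
  proof -
    have "2 powr (- 2 * s) < (1::real)" "2 powr (2 * s - 2) < (1::real)"
      using assms powr_less_mono[of "- 2 * s" 0 2] powr_less_mono[of "2 * s - 2" 0 2] by auto
    then show ?thesis
      unfolding b_def by (intro summable_add summable_mult summable_geometric) auto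
  qed
  have [measurable]: "F j \<in> sets borel" for j unfolding F_def by measurable
  have "UNIV = {0} \<union> (\<Union>j. F j)" using cover by blast
  then have "emeasure ?\<nu> UNIV \<le> emeasure ?\<nu> {0} + emeasure ?\<nu> (\<Union>j. F j)"
    using emeasure_subadditive[of "{0}" ?\<nu> "\<Union>j. F j"] by simp
  also have "emeasure ?\<nu> {0} = 0"
    by (subst emeasure_density) auto
  also have "emeasure ?\<nu> (\<Union>j. F j) \<le> (\<Sum>j. emeasure ?\<nu> (F j))"
    by (rule emeasure_subadditive_countably) auto
  also have "\<dots> \<le> (\<Sum>j. ennreal (b j))"
    by (intro suminf_le F_le) auto
  also have "\<dots> < \<infinity>"
    using suminf_ennreal2[OF b sb] by simp
  finally have "emeasure ?\<nu> UNIV < \<infinity>" by simp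
  then have "(\<integral>\<^sup>+ h. ennreal (?f h) \<partial>lborel) < \<infinity>"
    by (subst (asm) emeasure_density) auto
  then show ?thesis
    by (intro integrableI_nonneg) auto
qed

subsection \<open>Integration and elementary inequalities\<close>

lemma square_integrable_mult:
  fixes f g :: "'b \<Rightarrow> real"
  assumes [measurable]: "f \<in> borel_measurable M" "g \<in> borel_measurable M"
    and "integrable M (\<lambda>x. (f x)\<^sup>2)" "integrable M (\<lambda>x. (g x)\<^sup>2)"
  shows "integrable M (\<lambda>x. f x * g x)"
proof (rule Bochner_Integration.integrable_bound[of M "\<lambda>x. (f x)\<^sup>2 + (g x)\<^sup>2"])
  have "\<bar>f x * g x\<bar> \<le> (f x)\<^sup>2 + (g x)\<^sup>2" for x
  proof -
    have "0 \<le> \<bar>f x\<bar> * \<bar>g x\<bar>" "2 * (\<bar>f x\<bar> * \<bar>g x\<bar>) \<le> (f x)\<^sup>2 + (g x)\<^sup>2"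
      using sum_squares_bound[of "\<bar>f x\<bar>" "\<bar>g x\<bar>"] by simp_all
    then show ?thesis unfolding abs_mult by linarith
  qed
  then show "AE x in M. norm (f x * g x) \<le> norm ((f x)\<^sup>2 + (g x)\<^sup>2)" by simp
qed (use assms in auto)

lemma square_integrable_lincomb:
  fixes f g :: "'b \<Rightarrow> real"
  assumes [measurable]: "f \<in> borel_measurable M" "g \<in> borel_measurable M"
    and "integrable M (\<lambda>x. (f x)\<^sup>2)" "integrable M (\<lambda>x. (g x)\<^sup>2)"
  shows "integrable M (\<lambda>x. (a * f x + b * g x)\<^sup>2)"
proof -
  have "(a * f x + b * g x)\<^sup>2 = a\<^sup>2 * (f x)\<^sup>2 + b\<^sup>2 * (g x)\<^sup>2 + 2 * a * b * (f x * g x)" for x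
    by (simp add: power2_eq_square algebra_simps)
  then show ?thesis
    using assms square_integrable_mult[OF assms] by simp
qed

lemma Cauchy_Schwarz_integral:
  fixes f g :: "'b \<Rightarrow> real"
  assumes [measurable]: "f \<in> borel_measurable M" "g \<in> borel_measurable M"
    and f: "integrable M (\<lambda>x. (f x)\<^sup>2)" and g: "integrable M (\<lambda>x. (g x)\<^sup>2)"
  shows "(\<integral>x. f x * g x \<partial>M)\<^sup>2 \<le> (\<integral>x. (f x)\<^sup>2 \<partial>M) * (\<integral>x. (g x)\<^sup>2 \<partial>M)"
proof -
  have fg: "integrable M (\<lambda>x. f x * g x)"
    by (rule square_integrable_mult) (use assms in auto)
  have "ennreal ((\<integral>x. \<bar>f x * g x\<bar> \<partial>M)\<^sup>2) = (\<integral>\<^sup>+x. ennreal \<bar>f x\<bar> * ennreal \<bar>g x\<bar> \<partial>M)\<^sup>2"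
    using nn_integral_eq_integral[OF integrable_abs[OF fg]] by (simp add: ennreal_power abs_mult ennreal_mult)
  also have "\<dots> \<le> (\<integral>\<^sup>+x. ennreal \<bar>f x\<bar> ^ 2 \<partial>M) * (\<integral>\<^sup>+x. ennreal \<bar>g x\<bar> ^ 2 \<partial>M)"
    by (rule Cauchy_Schwarz_nn_integral) auto
  also have "\<dots> = ennreal ((\<integral>x. (f x)\<^sup>2 \<partial>M) * (\<integral>x. (g x)\<^sup>2 \<partial>M))"
    using f g by (simp add: nn_integral_eq_integral ennreal_power ennreal_mult)
  finally have "(\<integral>x. \<bar>f x * g x\<bar> \<partial>M)\<^sup>2 \<le> (\<integral>x. (f x)\<^sup>2 \<partial>M) * (\<integral>x. (g x)\<^sup>2 \<partial>M)"
    by (subst (asm) ennreal_le_iff) auto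
  moreover have "\<bar>\<integral>x. f x * g x \<partial>M\<bar> \<le> \<bar>\<integral>x. \<bar>f x * g x\<bar> \<partial>M\<bar>"
    using integral_abs_bound[of M "\<lambda>x. f x * g x"] by auto
  ultimately show ?thesis
    by (meson abs_le_square_iff order_trans)
qed

lemma lborel_distr_reflect:
  fixes c :: "'a::euclidean_space"
  shows "distr lborel borel (\<lambda>y. c - y) = lborel"
  using lborel_affine[of "-1" c] by (simp add: density_1)

text \<open>The exceptional pairs lie in two strips over a null set. This carries a.e. convergence
  of functions over to their differences on the product space.\<close>

lemma AE_lborel_pair:
  assumes "AE x in lborel. P (x :: 'a::euclidean_space)"
  shows "AE p in lborel \<Otimes>\<^sub>M (lborel :: 'a measure). P (fst p) \<and> P (snd p)"
proof -
  obtain N where N: "{x. \<not> P x} \<subseteq> N" "N \<in> null_sets lborel"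
    using assms by (auto elim!: AE_E simp: null_sets_def)
  show ?thesis
  proof (rule AE_I')
    show "N \<times> UNIV \<union> UNIV \<times> N \<in> null_sets (lborel \<Otimes>\<^sub>M (lborel :: 'a measure))"
      using N by (intro null_sets.Un lborel.times_in_null_sets1 lborel.times_in_null_sets2) auto
  qed (use N in auto)
qed

lemma powr_le_one_plus:
  fixes t q :: real
  assumes "0 \<le> t" "0 < q" "q < 1"
  shows "t powr q \<le> 1 + t"
proof (cases "t \<le> 1")
  case True
  then have "t powr q \<le> 1 powr q" using assms by (intro powr_mono2) auto
  then show ?thesis using assms by simp
next
  case False
  then have "t powr q \<le> t powr 1" using assms by (intro powr_mono) auto
  then show ?thesis using False by simp
qed

text \<open>The two regimes meet at the \<open>T\<close> with
  \<open>T powr (q - 1) = \<eta>\<close>: below it the left side is at most its value at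
  \<open>T\<close>, above it \<open>t powr (q - 1) \<le> \<eta>\<close> because
  \<open>q < 1\<close>. With small \<eta> the quadratic term can be absorbed into the
  energy.\<close>

lemma sublinear_young:
  fixes q \<eta> :: real
  assumes "0 < q" "q < 1" "0 < \<eta>"
  shows "\<exists>K\<ge>0. \<forall>t\<ge>0. t powr q * t \<le> \<eta> * t\<^sup>2 + K"
proof -
  define T where "T = \<eta> powr (1 / (q - 1))"
  have T: "0 < T" using assms by (simp add: T_def)
  have T_pow: "T powr (q - 1) = \<eta>" using assms by (simp add: T_def powr_powr)
  have "t powr q * t \<le> \<eta> * t\<^sup>2 + T powr q * T" if "0 \<le> t" for t
  proof (cases "t \<le> T")
    case True
    then have "t powr q * t \<le> T powr q * T"
      using that assms by (intro mult_mono powr_mono2) auto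
    then show ?thesis using assms by (simp add: add_increasing)
  next
    case False
    then have "t powr (q - 1) \<le> T powr (q - 1)"
      using T assms by (intro powr_mono2') auto
    then have "t powr (q - 1) * t\<^sup>2 \<le> \<eta> * t\<^sup>2" unfolding T_pow by (rule mult_right_mono) simp
    moreover have "t powr q = t powr (q - 1) * t"
      using False T by (simp add: powr_diff)
    ultimately have "t powr q * t \<le> \<eta> * t\<^sup>2" by (simp add: power2_eq_square mult.assoc)
    then show ?thesis using T by (simp add: add_increasing2)
  qed
  then show ?thesis using T by (intro exI[of _ "T powr q * T"]) auto
qed

subsection \<open>The energy space\<close>

locale frac_domain =
  fixes \<Omega> :: "'a::euclidean_space set" and s :: real
  assumes s_pos: "0 < s" and s_less_1: "s < 1"
    and open_dom: "open \<Omega>" and bounded_dom: "bounded \<Omega>" and dom_nonempty: "\<Omega> \<noteq> {}"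
begin

text \<open>With the singular kernel inside the measure, the energy form is the plain L2 product of
  \<open>delta u\<close> and \<open>delta v\<close>, so Cauchy-Schwarz and Fatou apply in their
  general form.\<close>

definition pair_meas :: "('a \<times> 'a) measure" where
  "pair_meas = density (lborel \<Otimes>\<^sub>M lborel) (\<lambda>p. ennreal (frac_kernel s (fst p - snd p)))"

definition delta :: "('a \<Rightarrow> real) \<Rightarrow> 'a \<times> 'a \<Rightarrow> real" where
  "delta u p = u (fst p) - u (snd p)"

text \<open>A convenient class inside \<open>Xs0\<close>: Borel representatives that vanish at every
  point outside \<Omega>. Square integrability follows from \<open>Poincare\<close>, and
  \<open>sob_Xs0\<close> gives the inclusion.\<close>

definition sob :: "('a \<Rightarrow> real) set" where
  "sob = {u \<in> borel_measurable borel. (\<forall>x. x \<notin> \<Omega> \<longrightarrow> u x = 0) \<and> integrable pair_meas (\<lambda>p. (delta u p)\<^sup>2)}"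

definition form :: "('a \<Rightarrow> real) \<Rightarrow> ('a \<Rightarrow> real) \<Rightarrow> real" where
  "form u v = (\<integral>p. delta u p * delta v p \<partial>pair_meas)"

lemma dom_borel [measurable]: "\<Omega> \<in> sets borel"
  using open_dom by simp

lemma emeasure_dom_finite: "emeasure lborel \<Omega> < \<infinity>"
  using bounded_dom by (rule emeasure_bounded_finite)

lemma sets_pair_meas [measurable_cong]: "sets pair_meas = sets (borel \<Otimes>\<^sub>M borel)"
  by (simp add: pair_meas_def cong: sets_pair_measure_cong)

lemma space_pair_meas [simp]: "space pair_meas = UNIV"
  by (simp add: pair_meas_def space_pair_measure)

lemma delta_measurable [measurable (raw)]:
  assumes [measurable]: "u \<in> borel_measurable borel"
  shows "delta u \<in> borel_measurable (borel \<Otimes>\<^sub>M borel)"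
  unfolding delta_def[abs_def] by measurable

lemma nn_integral_pair_meas:
  assumes [measurable]: "f \<in> borel_measurable (borel \<Otimes>\<^sub>M borel)"
  shows "(\<integral>\<^sup>+p. f p \<partial>pair_meas)
    = (\<integral>\<^sup>+p. ennreal (frac_kernel s (fst p - snd p)) * f p \<partial>(lborel \<Otimes>\<^sub>M lborel))"
  unfolding pair_meas_def by (rule nn_integral_density) measurable

lemma sobD:
  assumes "u \<in> sob"
  shows "u \<in> borel_measurable borel" "x \<notin> \<Omega> \<Longrightarrow> u x = 0" "integrable pair_meas (\<lambda>p. (delta u p)\<^sup>2)"
  using assms by (auto simp: sob_def)

lemma form_integrable:
  assumes "u \<in> sob" "v \<in> sob"
  shows "integrable pair_meas (\<lambda>p. delta u p * delta v p)"
proof -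
  have [measurable]: "u \<in> borel_measurable borel" "v \<in> borel_measurable borel"
    using assms by (auto simp: sob_def)
  show ?thesis
    by (rule square_integrable_mult) (use assms in \<open>auto simp: sob_def\<close>)
qed

section \<open>Linear structure of the energy space and bilinearity of the form\<close>

lemma delta_lincomb: "delta (\<lambda>x. a * u x + b * v x) p = a * delta u p + b * delta v p"
  by (simp add: delta_def algebra_simps)

lemma sob_lincomb:
  assumes "u \<in> sob" "v \<in> sob"
  shows "(\<lambda>x. a * u x + b * v x) \<in> sob"
proof -
  have [measurable]: "u \<in> borel_measurable borel" "v \<in> borel_measurable borel"
    using assms by (auto simp: sob_def)
  have "integrable pair_meas (\<lambda>p. (a * delta u p + b * delta v p)\<^sup>2)"
    by (rule square_integrable_lincomb) (use assms in \<open>auto simp: sob_def\<close>)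
  then show ?thesis
    using assms by (simp add: sob_def delta_lincomb)
qed

lemma form_lincomb:
  assumes "u \<in> sob" "v \<in> sob" "w \<in> sob"
  shows "form (\<lambda>x. a * u x + b * v x) w = a * form u w + b * form v w"
  using form_integrable[OF assms(1,3)] form_integrable[OF assms(2,3)]
  by (simp add: form_def delta_lincomb algebra_simps)

lemma sob_diff: "u \<in> sob \<Longrightarrow> v \<in> sob \<Longrightarrow> (\<lambda>x. u x - v x) \<in> sob"
  using sob_lincomb[of u v 1 "-1"] by simp

lemma sob_add: "u \<in> sob \<Longrightarrow> v \<in> sob \<Longrightarrow> (\<lambda>x. u x + v x) \<in> sob"
  using sob_lincomb[of u v 1 1] by simp

lemma sob_cmult: "u \<in> sob \<Longrightarrow> (\<lambda>x. a * u x) \<in> sob"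
  using sob_lincomb[of u u a 0] by simp

lemma form_commute: "form u v = form v u"
  by (simp add: form_def mult.commute)

lemma form_diff: "u \<in> sob \<Longrightarrow> v \<in> sob \<Longrightarrow> w \<in> sob \<Longrightarrow> form (\<lambda>x. u x - v x) w = form u w - form v w"
  using form_lincomb[of u v w 1 "-1"] by simp

lemma form_add: "u \<in> sob \<Longrightarrow> v \<in> sob \<Longrightarrow> w \<in> sob \<Longrightarrow> form (\<lambda>x. u x + v x) w = form u w + form v w"
  using form_lincomb[of u v w 1 1] by simp

lemma form_cmult: "u \<in> sob \<Longrightarrow> w \<in> sob \<Longrightarrow> form (\<lambda>x. a * u x) w = a * form u w"
  using form_lincomb[of u u w a 0] by simp

lemma form_nonneg [simp]: "0 \<le> form u u"
  by (simp add: form_def)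

lemma form_Cauchy_Schwarz:
  assumes "u \<in> sob" "v \<in> sob"
  shows "(form u v)\<^sup>2 \<le> form u u * form v v"
proof -
  have [measurable]: "u \<in> borel_measurable borel" "v \<in> borel_measurable borel"
    using assms by (auto simp: sob_def)
  show ?thesis
    unfolding form_def
    by (rule Cauchy_Schwarz_integral[of "delta u" pair_meas "delta v", unfolded power2_eq_square[of "delta _ _"]])
       (use assms in \<open>auto simp: sob_def power2_eq_square\<close>)
qed

lemma form_self_nn_integral:
  assumes "u \<in> sob"
  shows "ennreal (form u u) = (\<integral>\<^sup>+p. ennreal ((delta u p)\<^sup>2) \<partial>pair_meas)"
  using assms by (simp add: form_def sob_def nn_integral_eq_integral power2_eq_square)

lemma sob_nn_integralI:
  assumes [measurable]: "u \<in> borel_measurable borel" and "\<And>x. x \<notin> \<Omega> \<Longrightarrow> u x = 0"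
    and le: "(\<integral>\<^sup>+p. ennreal ((delta u p)\<^sup>2) \<partial>pair_meas) \<le> ennreal c" and "0 \<le> c"
  shows "u \<in> sob" "form u u \<le> c"
proof -
  show u: "u \<in> sob"
    unfolding sob_def using assms
    by (auto intro!: integrableI_nonneg intro: le_less_trans)
  show "form u u \<le> c"
    using form_self_nn_integral[OF u] le \<open>0 \<le> c\<close> by (simp flip: ennreal_le_iff)
qed

text \<open>Nonlocality makes this elementary: for \<open>x\<close> in \<Omega> and \<open>y\<close>
  in a fixed ball \<open>A\<close> outside, the difference is \<open>u x\<close> itself and the
  kernel is bounded below. These pairs alone contribute at least \<open>c * a\<close> times the
  squared L2 norm.\<close>

lemma Poincare:
  "\<exists>P>0. \<forall>u\<in>sob. integrable lborel (\<lambda>x. (u x)\<^sup>2) \<and> (\<integral>x. (u x)\<^sup>2 \<partial>lborel) \<le> P * form u u"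
proof -
  obtain R where R: "0 < R" "\<And>x. x \<in> \<Omega> \<Longrightarrow> norm x \<le> R"
    using bounded_dom by (auto simp: bounded_pos)
  obtain e :: 'a where e: "norm e = 1" using vector_choose_size[of 1] by auto
  \<comment> \<open>All points of this open unit ball have norm strictly between \<open>R\<close>
    and \<open>R + 2\<close>. Hence \<open>A\<close> misses \<Omega>, and its points are within
    \<open>2 * R + 2\<close> of those of \<Omega>, which fixes \<open>c\<close> below.\<close>
  define A where "A = ball ((R + 1) *\<^sub>R e) 1"
  have [measurable]: "A \<in> sets borel" by (simp add: A_def)
  have A: "R < norm y" "norm y < R + 2" if "y \<in> A" for y
  proof -
    have "norm ((R + 1) *\<^sub>R e) = R + 1" using e R by simp
    moreover have "norm ((R + 1) *\<^sub>R e - y) < 1" using that by (simp add: A_def dist_norm)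
    ultimately show "R < norm y" "norm y < R + 2"
      using norm_triangle_ineq2[of "(R + 1) *\<^sub>R e" y] norm_triangle_ineq2[of y "(R + 1) *\<^sub>R e"]
      by (auto simp: norm_minus_commute)
  qed
  define c where "c = 1 / (2 * R + 2) powr (real DIM('a) + 2 * s)"
  have c: "0 < c" using R by (simp add: c_def)
  have k: "c \<le> frac_kernel s (x - y)" if "x \<in> \<Omega>" "y \<in> A" for x y
  proof -
    have "norm (x - y) \<le> 2 * R + 2" "0 < norm (x - y)"
      using R(2)[OF that(1)] A[OF that(2)] norm_triangle_ineq4[of x y] by auto
    then show ?thesis
      unfolding c_def frac_kernel_def using s_pos
      by (intro divide_left_mono powr_mono2 mult_pos_pos) auto
  qed
  define a where "a = measure lborel A"
  have a: "0 < a" unfolding a_def A_def by (rule content_ball_pos) simp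
  have ea: "emeasure lborel A = ennreal a"
    unfolding a_def A_def
    using emeasure_lborel_ball_finite[of "(R + 1) *\<^sub>R e" 1] by (simp add: emeasure_eq_ennreal_measure)
  have main: "ennreal (c * a) * (\<integral>\<^sup>+x. ennreal ((u x)\<^sup>2) \<partial>lborel) \<le> ennreal (form u u)"
    if "u \<in> sob" for u
  proof -
    have [measurable]: "u \<in> borel_measurable borel" using that by (rule sobD)
    have "ennreal (c * a) * (\<integral>\<^sup>+x. ennreal ((u x)\<^sup>2) \<partial>lborel)
        = (\<integral>\<^sup>+x. (\<integral>\<^sup>+y. ennreal (c * (u x)\<^sup>2) * indicator A y \<partial>lborel) \<partial>lborel)"
    proof -
      have "(\<integral>\<^sup>+y. ennreal (c * (u x)\<^sup>2) * indicator A y \<partial>lborel) = ennreal (c * a) * ennreal ((u x)\<^sup>2)" for x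
        using c a by (subst nn_integral_cmult_indicator) (simp_all add: ea mult_ac flip: ennreal_mult)
      then show ?thesis by (simp add: nn_integral_cmult)
    qed
    also have "\<dots> = (\<integral>\<^sup>+p. ennreal (c * (u (fst p))\<^sup>2) * indicator A (snd p) \<partial>(lborel \<Otimes>\<^sub>M lborel))"
      by (subst lborel.nn_integral_fst[symmetric]) auto
    also have "\<dots> \<le> (\<integral>\<^sup>+p. ennreal (frac_kernel s (fst p - snd p)) * ennreal ((delta u p)\<^sup>2) \<partial>(lborel \<Otimes>\<^sub>M lborel))"
    proof (rule nn_integral_mono)
      fix p :: "'a \<times> 'a"
      show "ennreal (c * (u (fst p))\<^sup>2) * indicator A (snd p)
          \<le> ennreal (frac_kernel s (fst p - snd p)) * ennreal ((delta u p)\<^sup>2)"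
      proof (cases "fst p \<in> \<Omega> \<and> snd p \<in> A")
        case True
        then have "snd p \<notin> \<Omega>" using A R by force
        then have "delta u p = u (fst p)" by (simp add: delta_def sobD[OF that])
        then show ?thesis
          using True k[of "fst p" "snd p"] c
          by (auto simp flip: ennreal_mult intro!: ennreal_leI mult_right_mono)
      next
        case False
        then show ?thesis by (auto simp: sobD[OF that] indicator_def)
      qed
    qed
    also have "\<dots> = ennreal (form u u)"
      by (simp add: form_self_nn_integral[OF that] nn_integral_pair_meas)
    finally show ?thesis .
  qed
  have fin: "integrable lborel (\<lambda>x. (u x)\<^sup>2)" if "u \<in> sob" for u
  proof -
    have [measurable]: "u \<in> borel_measurable borel" using that by (rule sobD)
    have "ennreal (c * a) * (\<integral>\<^sup>+x. ennreal ((u x)\<^sup>2) \<partial>lborel) < \<infinity>"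
      using main[OF that] by (auto intro: le_less_trans)
    then have "(\<integral>\<^sup>+x. ennreal ((u x)\<^sup>2) \<partial>lborel) < \<infinity>"
      using c a by (auto simp: ennreal_mult_less_top)
    then show ?thesis by (intro integrableI_nonneg) auto
  qed
  show ?thesis
  proof (intro exI[of _ "1 / (c * a)"] conjI ballI)
    fix u assume u: "u \<in> sob"
    have "c * a * (\<integral>x. (u x)\<^sup>2 \<partial>lborel) \<le> form u u"
      using main[OF u] fin[OF u] c a
      by (simp add: nn_integral_eq_integral flip: ennreal_mult)
    then show "(\<integral>x. (u x)\<^sup>2 \<partial>lborel) \<le> 1 / (c * a) * form u u"
      using c a by (simp add: field_simps)
  qed (use c a fin in auto)
qed

text \<open>Both claims reduce to pointwise inequalities for \<open>max 0 a - max 0 b\<close>. The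
  second is the nonlocal counterpart of the identity for gradients of positive parts, and is what
  makes the weak comparison in \<open>monotone_step\<close> work.\<close>

lemma sob_positive_part:
  assumes "u \<in> sob"
  shows "(\<lambda>x. max 0 (u x)) \<in> sob"
    "form (\<lambda>x. max 0 (u x)) (\<lambda>x. max 0 (u x)) \<le> form u (\<lambda>x. max 0 (u x))"
proof -
  let ?w = "\<lambda>x. max 0 (u x)"
  have [measurable]: "u \<in> borel_measurable borel" using assms by (rule sobD)
  have le: "(delta ?w p)\<^sup>2 \<le> delta u p * delta ?w p" "(delta ?w p)\<^sup>2 \<le> (delta u p)\<^sup>2" for p
  proof -
    have "(max 0 a - max 0 b)\<^sup>2 \<le> (a - b) * (max 0 a - max 0 b)" for a b :: real
      by (cases "0 \<le> a"; cases "0 \<le> b")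
         (auto simp: max_def power2_eq_square algebra_simps mult_nonneg_nonpos mult_nonpos_nonneg)
    then show "(delta ?w p)\<^sup>2 \<le> delta u p * delta ?w p" by (simp add: delta_def)
    show "(delta ?w p)\<^sup>2 \<le> (delta u p)\<^sup>2"
      by (subst abs_le_square_iff[symmetric]) (auto simp: delta_def max_def)
  qed
  have "integrable pair_meas (\<lambda>p. (delta ?w p)\<^sup>2)"
    by (rule Bochner_Integration.integrable_bound[OF sobD(3)[OF assms]]) (use le in auto)
  then show w: "?w \<in> sob"
    using assms by (auto simp: sob_def)
  show "form ?w ?w \<le> form u ?w"
    unfolding form_def
    by (rule integral_mono) (use form_integrable assms w le in \<open>auto simp: power2_eq_square\<close>)
qed

section \<open>Membership criteria: Lipschitz functions and limits of Cauchy sequences\<close>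

lemma kernel_shift:
  fixes x :: 'a
  shows "(\<integral>\<^sup>+y. ennreal (min 1 ((norm (x - y))\<^sup>2) * frac_kernel s (x - y)) \<partial>lborel)
    = (\<integral>\<^sup>+h. ennreal (min 1 ((norm h)\<^sup>2) * frac_kernel s (h :: 'a)) \<partial>lborel)"
proof -
  have "(\<integral>\<^sup>+h. ennreal (min 1 ((norm h)\<^sup>2) * frac_kernel s (h :: 'a)) \<partial>distr lborel borel (\<lambda>y::'a. x - y))
    = (\<integral>\<^sup>+y. ennreal (min 1 ((norm (x - y))\<^sup>2) * frac_kernel s (x - y)) \<partial>lborel)"
    by (subst nn_integral_distr) auto
  then show ?thesis by (simp add: lborel_distr_reflect)
qed

text \<open>The squared difference is at most a constant times
  \<open>min 1 ((norm (x - y))\<^sup>2)\<close> and vanishes unless one of the points lies in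
  \<Omega>. Integrating over the other point first gives the finite integral of
  \<open>integrable_frac_kernel\<close>, and \<Omega> has finite volume.\<close>

lemma lipschitz_in_sob:
  assumes lipschitz: "L-lipschitz_on UNIV u" and bounded: "\<And>x. \<bar>u x\<bar> \<le> M"
    and out: "\<And>x. x \<notin> \<Omega> \<Longrightarrow> u x = 0"
  shows "u \<in> sob"
proof -
  have [measurable]: "u \<in> borel_measurable borel"
    using lipschitz_on_continuous_on[OF lipschitz] by (rule borel_measurable_continuous_onI)
  define C where "C = L\<^sup>2 + (2 * M)\<^sup>2"
  have lip: "(u x - u y)\<^sup>2 \<le> C * min 1 ((norm (x - y))\<^sup>2)" for x y
  proof -
    have "\<bar>u x - u y\<bar>\<^sup>2 \<le> (2 * M)\<^sup>2"
      using bounded[of x] bounded[of y] by (intro power_mono) auto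
    moreover have "\<bar>u x - u y\<bar>\<^sup>2 \<le> (L * norm (x - y))\<^sup>2"
      using lipschitz_onD[OF lipschitz, of x y] by (intro power_mono) (auto simp: dist_norm)
    ultimately show ?thesis
      unfolding C_def by (auto simp: min_def power_mult_distrib distrib_right intro: add_increasing add_increasing2)
  qed
  let ?m = "\<lambda>h::'a. min 1 ((norm h)\<^sup>2) * frac_kernel s h"
  let ?I = "(\<integral>\<^sup>+h. ennreal (?m h) \<partial>lborel)"
  have I: "?I < \<infinity>"
    using integrable_frac_kernel[OF s_pos s_less_1, where 'a='a] by (simp add: nn_integral_eq_integral)
  have C: "0 \<le> C"
  proof -
    obtain e :: 'a where "norm e = 1" using vector_choose_size[of 1] by auto
    then show ?thesis using order_trans[OF zero_le_power2 lip[of e 0]] by simp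
  qed
  have "(\<integral>\<^sup>+p. ennreal ((delta u p)\<^sup>2) \<partial>pair_meas)
      = (\<integral>\<^sup>+p. ennreal (frac_kernel s (fst p - snd p)) * ennreal ((delta u p)\<^sup>2) \<partial>(lborel \<Otimes>\<^sub>M lborel))"
    by (rule nn_integral_pair_meas) measurable
  also have "\<dots> \<le> (\<integral>\<^sup>+p. ennreal C * indicator \<Omega> (fst p) * ennreal (?m (fst p - snd p))
      + ennreal C * indicator \<Omega> (snd p) * ennreal (?m (fst p - snd p)) \<partial>(lborel \<Otimes>\<^sub>M lborel))"
  proof (rule nn_integral_mono)
    fix p :: "'a \<times> 'a"
    let ?X = "ennreal (frac_kernel s (fst p - snd p)) * ennreal ((delta u p)\<^sup>2)"
    have "frac_kernel s (fst p - snd p) * (delta u p)\<^sup>2 \<le> C * ?m (fst p - snd p)"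
      using mult_left_mono[OF lip[of "fst p" "snd p"] frac_kernel_nonneg[of s "fst p - snd p"]]
      by (simp add: delta_def mult_ac)
    then have "?X \<le> ennreal C * ennreal (?m (fst p - snd p))"
      using C by (simp add: ennreal_leI flip: ennreal_mult)
    moreover have "?X = 0" if "fst p \<notin> \<Omega>" "snd p \<notin> \<Omega>"
      using that by (simp add: delta_def out)
    ultimately show "?X \<le> ennreal C * indicator \<Omega> (fst p) * ennreal (?m (fst p - snd p))
      + ennreal C * indicator \<Omega> (snd p) * ennreal (?m (fst p - snd p))"
      by (cases "fst p \<in> \<Omega>"; cases "snd p \<in> \<Omega>") (auto intro: add_increasing2)
  qed
  also have "\<dots> = (\<integral>\<^sup>+p. ennreal C * indicator \<Omega> (fst p) * ennreal (?m (fst p - snd p)) \<partial>(lborel \<Otimes>\<^sub>M lborel))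
      + (\<integral>\<^sup>+p. ennreal C * indicator \<Omega> (snd p) * ennreal (?m (fst p - snd p)) \<partial>(lborel \<Otimes>\<^sub>M lborel))"
    by (rule nn_integral_add) auto
  also have "(\<integral>\<^sup>+p. ennreal C * indicator \<Omega> (fst p) * ennreal (?m (fst p - snd p)) \<partial>(lborel \<Otimes>\<^sub>M lborel))
      = ennreal C * emeasure lborel \<Omega> * ?I"
    by (subst lborel.nn_integral_fst[symmetric])
       (auto simp: nn_integral_cmult kernel_shift nn_integral_multc)
  also have "(\<integral>\<^sup>+p. ennreal C * indicator \<Omega> (snd p) * ennreal (?m (fst p - snd p)) \<partial>(lborel \<Otimes>\<^sub>M lborel))
      = ennreal C * emeasure lborel \<Omega> * ?I"
    by (subst lborel_pair.nn_integral_snd[symmetric])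
       (auto simp: nn_integral_cmult kernel_shift nn_integral_multc norm_minus_commute[of _ "_ :: 'a"] frac_kernel_commute)
  finally have "(\<integral>\<^sup>+p. ennreal ((delta u p)\<^sup>2) \<partial>pair_meas) \<le> ennreal C * emeasure lborel \<Omega> * ?I + ennreal C * emeasure lborel \<Omega> * ?I" .
  also have "\<dots> < \<infinity>"
    using I emeasure_dom_finite by (auto simp: ennreal_mult_less_top)
  finally show ?thesis
    unfolding sob_def using out by (auto intro!: integrableI_nonneg)
qed

text \<open>Fatou's lemma in \<open>n\<close>, with \<open>m\<close> fixed, passes the Cauchy bound
  \<open>e m\<close> to the limit. This serves as completeness of the energy space, for the
  minimising sequence and for the monotone iteration alike.\<close>

lemma sob_limit:
  assumes w: "\<And>n. w n \<in> sob" and [measurable]: "u \<in> borel_measurable borel"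
    and out: "\<And>x. x \<notin> \<Omega> \<Longrightarrow> u x = 0"
    and lim: "AE x in lborel. (\<lambda>n. w n x) \<longlonglongrightarrow> u x"
    and cau: "\<And>m n. m \<le> n \<Longrightarrow> form (\<lambda>x. w n x - w m x) (\<lambda>x. w n x - w m x) \<le> e m"
  shows "u \<in> sob" "form (\<lambda>x. u x - w m x) (\<lambda>x. u x - w m x) \<le> e m"
proof -
  have [measurable]: "w n \<in> borel_measurable borel" for n using w by (rule sobD)
  have ae: "AE p in pair_meas. \<forall>m. (\<lambda>n. (delta (\<lambda>x. w n x - w m x) p)\<^sup>2) \<longlonglongrightarrow> (delta (\<lambda>x. u x - w m x) p)\<^sup>2"
  proof -
    have "AE p in lborel \<Otimes>\<^sub>M lborel. \<forall>m. (\<lambda>n. (delta (\<lambda>x. w n x - w m x) p)\<^sup>2) \<longlonglongrightarrow> (delta (\<lambda>x. u x - w m x) p)\<^sup>2"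
      using AE_lborel_pair[OF lim]
      by eventually_elim (auto simp: delta_def intro!: tendsto_intros)
    then show ?thesis
      unfolding pair_meas_def by (subst AE_density) auto
  qed
  have le: "(\<integral>\<^sup>+p. ennreal ((delta (\<lambda>x. u x - w m x) p)\<^sup>2) \<partial>pair_meas) \<le> ennreal (e m)" for m
  proof -
    have "(\<integral>\<^sup>+p. ennreal ((delta (\<lambda>x. u x - w m x) p)\<^sup>2) \<partial>pair_meas)
      = (\<integral>\<^sup>+p. liminf (\<lambda>n. ennreal ((delta (\<lambda>x. w n x - w m x) p)\<^sup>2)) \<partial>pair_meas)"
      by (rule nn_integral_cong_AE, rule AE_mp[OF ae])
         (auto intro!: AE_I2 lim_imp_Liminf[symmetric] tendsto_ennrealI)
    also have "\<dots> \<le> liminf (\<lambda>n. \<integral>\<^sup>+p. ennreal ((delta (\<lambda>x. w n x - w m x) p)\<^sup>2) \<partial>pair_meas)"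
      by (rule nn_integral_liminf) measurable
    also have "\<dots> \<le> ennreal (e m)"
      by (rule Liminf_le[OF sequentially_bot], rule eventually_sequentiallyI[of m])
         (use cau in \<open>auto simp: sob_diff w ennreal_leI simp flip: form_self_nn_integral\<close>)
    finally show ?thesis .
  qed
  have e: "0 \<le> e m" for m using order_trans[OF form_nonneg cau[OF order_refl]] .
  have *: "(\<lambda>x. u x - w m x) \<in> sob" "form (\<lambda>x. u x - w m x) (\<lambda>x. u x - w m x) \<le> e m" for m
    using le[of m] e[of m] by (auto intro!: sob_nn_integralI simp: out sobD[OF w])
  show "form (\<lambda>x. u x - w m x) (\<lambda>x. u x - w m x) \<le> e m" by (rule *)
  show "u \<in> sob" using sob_add[OF *(1)[of 0] w[of 0]] by simp
qed

subsection \<open>Riesz representation\<close>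

text \<open>Since \<Omega> has finite volume, L2 increments of size \<open>(1/2) ^ n\<close> have
  summable L1 norms. The series of increments then converges absolutely almost everywhere, and its
  partial sums telescope.\<close>

lemma AE_convergent_of_fast_L2:
  fixes w :: "nat \<Rightarrow> 'a \<Rightarrow> real"
  assumes [measurable]: "\<And>n. w n \<in> borel_measurable borel"
    and out: "\<And>n x. x \<notin> \<Omega> \<Longrightarrow> w n x = 0"
    and int: "\<And>n. integrable lborel (\<lambda>x. (w (Suc n) x - w n x)\<^sup>2)"
    and le: "\<And>n. (\<integral>x. (w (Suc n) x - w n x)\<^sup>2 \<partial>lborel) \<le> c * (1/4) ^ n"
  shows "AE x in lborel. convergent (\<lambda>n. w n x)"
proof -
  define d where "d n x = \<bar>w (Suc n) x - w n x\<bar>" for n x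
  have [measurable]: "d n \<in> borel_measurable borel" for n unfolding d_def by measurable
  define V where "V = measure lborel \<Omega>"
  have V: "0 \<le> V" and c: "0 \<le> c"
    using order_trans[OF _ le[of 0]] by (auto simp: V_def)
  have indi: "integrable lborel (\<lambda>x. indicator \<Omega> x :: real)"
    using emeasure_dom_finite by simp
  have d: "(\<integral>\<^sup>+x. ennreal (d n x) \<partial>lborel) \<le> ennreal ((c + V) * (1/2) ^ n)" for n
  proof -
    have "(\<integral>\<^sup>+x. ennreal (d n x) \<partial>lborel)
        \<le> (\<integral>\<^sup>+x. ennreal (2 ^ n * (w (Suc n) x - w n x)\<^sup>2 + (1/2) ^ n * indicator \<Omega> x) \<partial>lborel)"
    proof (intro nn_integral_mono ennreal_leI)
      fix x
      show "d n x \<le> 2 ^ n * (w (Suc n) x - w n x)\<^sup>2 + (1/2) ^ n * indicator \<Omega> x"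
      proof (cases "x \<in> \<Omega>")
        case True
        \<comment> \<open>The weight \<open>2 ^ n\<close> balances the terms: \<open>2 ^ n\<close>
          times \<open>(1/4) ^ n\<close> and the remainder \<open>1 / 2 ^ n\<close> are both of
          order \<open>(1/2) ^ n\<close>.\<close>
        have "0 \<le> (2 ^ n * d n x - 1)\<^sup>2" by simp
        then have "2 * (2 ^ n * d n x) \<le> (2 ^ n)\<^sup>2 * (d n x)\<^sup>2 + 1"
          by (simp add: power2_diff power_mult_distrib)
        moreover have "0 \<le> 2 ^ n * d n x" by (simp add: d_def)
        ultimately have "2 ^ n * d n x \<le> (2 ^ n)\<^sup>2 * (d n x)\<^sup>2 + 1" by linarith
        then have "d n x \<le> 2 ^ n * (d n x)\<^sup>2 + 1 / 2 ^ n"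
          by (simp add: field_simps power2_eq_square)
        then show ?thesis using True by (simp add: d_def power_divide)
      qed (simp add: d_def out)
    qed
    also have "\<dots> = ennreal (\<integral>x. 2 ^ n * (w (Suc n) x - w n x)\<^sup>2 + (1/2) ^ n * indicator \<Omega> x \<partial>lborel)"
      using int[of n] indi by (intro nn_integral_eq_integral) auto
    also have "\<dots> \<le> ennreal ((c + V) * (1/2) ^ n)"
    proof (rule ennreal_leI)
      have "2 ^ n * (\<integral>x. (w (Suc n) x - w n x)\<^sup>2 \<partial>lborel) \<le> 2 ^ n * (c * (1/4) ^ n)"
        by (rule mult_left_mono[OF le]) simp
      also have "\<dots> = c * (2 * (1/4)) ^ n"
        by (simp only: power_mult_distrib mult.left_commute)
      also have "2 * (1/4) = (1/2 :: real)" by simp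
      finally show "(\<integral>x. 2 ^ n * (w (Suc n) x - w n x)\<^sup>2 + (1/2) ^ n * indicator \<Omega> x \<partial>lborel) \<le> (c + V) * (1/2) ^ n"
        using int[of n] indi by (simp add: V_def algebra_simps)
    qed
    finally show ?thesis .
  qed
  have "(\<integral>\<^sup>+x. (\<Sum>n. ennreal (d n x)) \<partial>lborel) = (\<Sum>n. \<integral>\<^sup>+x. ennreal (d n x) \<partial>lborel)"
    by (rule nn_integral_suminf) measurable
  also have "\<dots> \<le> (\<Sum>n. ennreal ((c + V) * (1/2) ^ n))"
    by (intro suminf_le d) auto
  also have "\<dots> < \<infinity>"
    by (subst suminf_ennreal2) (use V c in \<open>auto intro!: summable_mult summable_geometric\<close>)
  finally have "AE x in lborel. (\<Sum>n. ennreal (d n x)) \<noteq> \<infinity>"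
    by (intro nn_integral_PInf_AE) auto
  then show ?thesis
  proof eventually_elim
    fix x assume "(\<Sum>n. ennreal (d n x)) \<noteq> \<infinity>"
    then have "summable (\<lambda>n. d n x)"
      by (intro summable_suminf_not_top) (auto simp: d_def)
    then have "summable (\<lambda>n. w (Suc n) x - w n x)"
      unfolding d_def by (rule summable_rabs_cancel)
    then have "convergent (\<lambda>n. \<Sum>i<n. w (Suc i) x - w i x)"
      by (simp add: summable_iff_convergent)
    then have "convergent (\<lambda>n. (w n x - w 0 x) + w 0 x)"
      unfolding sum_lessThan_telescope[of "\<lambda>i. w i x"] by (intro convergent_add convergent_const)
    then show "convergent (\<lambda>n. w n x)" by simp
  qed
qed

lemma sob_square_integrable: "u \<in> sob \<Longrightarrow> integrable lborel (\<lambda>x. (u x)\<^sup>2)"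
  using Poincare by blast

lemma integrable_mult_sob:
  assumes "F \<in> borel_measurable borel" "integrable lborel (\<lambda>x. (F x)\<^sup>2)" "\<phi> \<in> sob"
  shows "integrable lborel (\<lambda>x. F x * \<phi> x)"
  using assms sobD(1)[OF assms(3)] sob_square_integrable[OF assms(3)]
  by (intro square_integrable_mult) auto

text \<open>Direct method: the functional \<open>J u = form u u - 2 * L u\<close> is bounded below,
  the parallelogram identity makes a minimising sequence Cauchy in energy, and vanishing of the
  first variation is the equation.\<close>

theorem Riesz_representation:
  fixes F :: "'a \<Rightarrow> real"
  assumes [measurable]: "F \<in> borel_measurable borel" and F2: "integrable lborel (\<lambda>x. (F x)\<^sup>2)"
  obtains u where "u \<in> sob" "\<And>\<phi>. \<phi> \<in> sob \<Longrightarrow> form u \<phi> = (\<integral>x. F x * \<phi> x \<partial>lborel)"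
proof -
  obtain P where P: "0 < P" "\<And>u. u \<in> sob \<Longrightarrow> integrable lborel (\<lambda>x. (u x)\<^sup>2)"
    "\<And>u. u \<in> sob \<Longrightarrow> (\<integral>x. (u x)\<^sup>2 \<partial>lborel) \<le> P * form u u"
    by (use Poincare in force)
  define L where "L \<phi> = (\<integral>x. F x * \<phi> x \<partial>lborel)" for \<phi>
  have Fphi: "integrable lborel (\<lambda>x. F x * \<phi> x)" if "\<phi> \<in> sob" for \<phi>
    using assms that by (rule integrable_mult_sob)
  have L_lin: "L (\<lambda>x. a * u x + b * v x) = a * L u + b * L v" if "u \<in> sob" "v \<in> sob" for a b u v
  proof -
    have "L (\<lambda>x. a * u x + b * v x) = (\<integral>x. a * (F x * u x) + b * (F x * v x) \<partial>lborel)"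
      unfolding L_def by (rule Bochner_Integration.integral_cong) (auto simp: algebra_simps)
    also have "\<dots> = a * L u + b * L v"
      using Fphi[OF that(1)] Fphi[OF that(2)] by (simp add: L_def)
    finally show ?thesis .
  qed
  define K where "K = P * (\<integral>x. (F x)\<^sup>2 \<partial>lborel)"
  have K: "0 \<le> K" using P by (simp add: K_def)
  \<comment> \<open>Cauchy-Schwarz and Poincare give
    \<open>(L u)\<^sup>2 \<le> K * form u u\<close>; the inequality of arithmetic and geometric
    means finishes. Consequently \<open>J\<close> is at least \<open>- K\<close>.\<close>
  have L_bound: "2 * L u \<le> K + form u u" if "u \<in> sob" for u
  proof -
    have "(L u)\<^sup>2 \<le> (\<integral>x. (F x)\<^sup>2 \<partial>lborel) * (\<integral>x. (u x)\<^sup>2 \<partial>lborel)"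
      unfolding L_def by (rule Cauchy_Schwarz_integral) (use sobD(1)[OF that] F2 P(2)[OF that] in auto)
    also have "\<dots> \<le> (\<integral>x. (F x)\<^sup>2 \<partial>lborel) * (P * form u u)"
      using P(3)[OF that] by (intro mult_left_mono) auto
    also have "\<dots> = K * form u u" by (simp add: K_def)
    finally have "(2 * L u)\<^sup>2 \<le> 4 * (K * form u u)" by (simp add: power_mult_distrib)
    also have "\<dots> \<le> (K + form u u)\<^sup>2"
      using zero_le_power2[of "K - form u u"] by (simp add: power2_eq_square algebra_simps)
    finally show ?thesis
      by (rule power2_le_imp_le) (use K in auto)
  qed
  define J where "J u = form u u - 2 * L u" for u
  define m where "m = Inf (J ` sob)"
  have zero: "(\<lambda>x. 0) \<in> sob" by (simp add: sob_def delta_def)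
  have bdd: "bdd_below (J ` sob)"
    by (rule bdd_belowI[of _ "- K"]) (use L_bound in \<open>force simp: J_def\<close>)
  have m_le: "m \<le> J u" if "u \<in> sob" for u
    unfolding m_def using bdd that by (intro cInf_lower) auto
  \<comment> \<open>The tolerance \<open>(1/4) ^ n\<close> is the decay rate required by
    \<open>AE_convergent_of_fast_L2\<close>.\<close>
  have "\<exists>u. u \<in> sob \<and> J u < m + (1/4) ^ n" for n :: nat
    using cInf_lessD[of "J ` sob" "m + (1/4) ^ n"] zero by (auto simp: m_def)
  then obtain w where w: "\<And>n. w n \<in> sob" and Jw: "\<And>n. J (w n) < m + (1/4) ^ n" by metis
  have J_lin: "J (\<lambda>x. a * u x + b * v x)
      = a\<^sup>2 * form u u + 2 * a * b * form u v + b\<^sup>2 * form v v - 2 * (a * L u + b * L v)"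
    if "u \<in> sob" "v \<in> sob" for a b u v
  proof -
    have "form (\<lambda>x. a * u x + b * v x) (\<lambda>x. a * u x + b * v x)
        = a * form u (\<lambda>x. a * u x + b * v x) + b * form v (\<lambda>x. a * u x + b * v x)"
      using that by (intro form_lincomb sob_lincomb) auto
    also have "form u (\<lambda>x. a * u x + b * v x) = a * form u u + b * form u v"
      using form_lincomb[OF that that(1), of a b] form_commute[of v u]
        form_commute[of u "\<lambda>x. a * u x + b * v x"] by simp
    also have "form v (\<lambda>x. a * u x + b * v x) = a * form u v + b * form v v"
      using form_lincomb[OF that that(2), of a b]
        form_commute[of v "\<lambda>x. a * u x + b * v x"] by simp
    finally show ?thesis
      unfolding J_def L_lin[OF that] by (simp add: power2_eq_square algebra_simps)
  qed
  have form_diff_self: "form (\<lambda>x. u x - v x) (\<lambda>x. u x - v x) = form u u - 2 * form u v + form v v"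
    if "u \<in> sob" "v \<in> sob" for u v
  proof -
    note d = form_diff[OF that]
    have "form (\<lambda>x. u x - v x) (\<lambda>x. u x - v x) = form u (\<lambda>x. u x - v x) - form v (\<lambda>x. u x - v x)"
      by (rule d[OF sob_diff[OF that]])
    then show ?thesis
      using d[OF that(1)] d[OF that(2)] form_commute[of u "\<lambda>x. u x - v x"]
        form_commute[of v "\<lambda>x. u x - v x"] form_commute[of v u] by linarith
  qed
  \<comment> \<open>The midpoint of \<open>w n\<close> and \<open>w k\<close> also has
    \<open>J\<close> at least \<open>m\<close>; by the parallelogram identity the energy of the
    difference is at most twice the sum of the two excesses over \<open>m\<close>.\<close>
  have cauchy: "form (\<lambda>x. w n x - w k x) (\<lambda>x. w n x - w k x) \<le> 4 * (1/4) ^ k" if "k \<le> n" for n k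
  proof -
    have "m \<le> J (\<lambda>x. (1/2) * w n x + (1/2) * w k x)"
      by (intro m_le sob_lincomb w)
    then have "form (\<lambda>x. w n x - w k x) (\<lambda>x. w n x - w k x) \<le> 2 * (J (w n) - m) + 2 * (J (w k) - m)"
      unfolding J_lin[OF w w] form_diff_self[OF w w] by (simp add: J_def power2_eq_square)
    moreover have "(1/4 :: real) ^ n \<le> (1/4) ^ k"
      using that by (intro power_decreasing) auto
    ultimately show ?thesis using Jw[of n] Jw[of k] by argo
  qed
  have [measurable]: "w n \<in> borel_measurable borel" for n using w by (rule sobD)
  have conv: "AE x in lborel. convergent (\<lambda>n. w n x)"
  proof (rule AE_convergent_of_fast_L2[where c = "P * 4"])
    fix n
    have "(\<integral>x. (w (Suc n) x - w n x)\<^sup>2 \<partial>lborel) \<le> P * form (\<lambda>x. w (Suc n) x - w n x) (\<lambda>x. w (Suc n) x - w n x)"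
      by (intro P sob_diff w)
    also have "\<dots> \<le> P * (4 * (1/4) ^ n)"
      using P by (intro mult_left_mono cauchy) auto
    finally show "(\<integral>x. (w (Suc n) x - w n x)\<^sup>2 \<partial>lborel) \<le> P * 4 * (1/4) ^ n" by simp
    show "integrable lborel (\<lambda>x. (w (Suc n) x - w n x)\<^sup>2)"
      by (intro P sob_diff w)
  qed (auto simp: sobD[OF w])
  define u where "u x = lim (\<lambda>n. w n x)" for x
  have [measurable]: "u \<in> borel_measurable borel" unfolding u_def by measurable
  have u_lim: "AE x in lborel. (\<lambda>n. w n x) \<longlonglongrightarrow> u x"
    using conv by eventually_elim (simp add: u_def convergent_LIMSEQ_iff)
  have u_out: "u x = 0" if "x \<notin> \<Omega>" for x
    using that by (simp add: u_def sobD[OF w])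
  have u: "u \<in> sob"
    and uw: "form (\<lambda>x. u x - w k x) (\<lambda>x. u x - w k x) \<le> 4 * (1/4) ^ k" for k
    using sob_limit[where e = "\<lambda>k. 4 * (1/4) ^ k", OF w _ u_out u_lim cauchy] by auto
  have "form u \<phi> = L \<phi>" if \<phi>: "\<phi> \<in> sob" for \<phi>
  proof -
    \<comment> \<open>The defect of \<open>u\<close> is split into the defect \<open>a\<close> of
      \<open>w n\<close>, small by near-minimality, and the form \<open>b\<close> of
      \<open>u - w n\<close> with \<phi>, small by energy convergence.\<close>
    have "(form u \<phi> - L \<phi>)\<^sup>2 \<le> 2 * ((1/4) ^ n * (1 + form \<phi> \<phi>)\<^sup>2) + 8 * ((1/4) ^ n * form \<phi> \<phi>)" for n
    proof -
      have step: "- ((1/4) ^ n) \<le> 2 * t * (form (w n) \<phi> - L \<phi>) + t\<^sup>2 * form \<phi> \<phi>" for t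
      proof -
        have "m \<le> J (\<lambda>x. 1 * w n x + t * \<phi> x)"
          by (intro m_le sob_lincomb w \<phi>)
        then show ?thesis
          using Jw[of n] unfolding J_lin[OF w \<phi>] by (simp add: J_def algebra_simps)
      qed
      \<comment> \<open>The step length is the square root of the tolerance, so that tolerance and
        quadratic term in \<open>step\<close> have the same order. The choices \<open>t = r\<close>
        and \<open>t = - r\<close> bound \<open>a\<close> from both sides.\<close>
      define r :: real where "r = (1/2) ^ n"
      have r: "0 < r" by (simp add: r_def)
      have sq: "(1/4) ^ n = r\<^sup>2"
        unfolding r_def by (simp only: power_commutes power2_eq_square flip: power_mult_distrib) simp
      define a where "a = form (w n) \<phi> - L \<phi>"
      have "2 * \<bar>a\<bar> \<le> r * (1 + form \<phi> \<phi>)"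
      proof -
        have "- (r * r) \<le> 2 * r * a + r * r * form \<phi> \<phi>" "- (r * r) \<le> 2 * (- r) * a + r * r * form \<phi> \<phi>"
          using step[of r] step[of "- r"] unfolding a_def sq power2_eq_square by simp_all
        then have "r * (2 * \<bar>a\<bar>) \<le> r * (r * (1 + form \<phi> \<phi>))"
          by (cases "0 \<le> a") (simp_all add: algebra_simps)
        then show ?thesis using r by (simp only: mult_le_cancel_left_pos)
      qed
      then have "\<bar>a\<bar> \<le> r * (1 + form \<phi> \<phi>)" by linarith
      then have "\<bar>a\<bar>\<^sup>2 \<le> (r * (1 + form \<phi> \<phi>))\<^sup>2"
        by (rule power_mono) simp
      then have a: "a\<^sup>2 \<le> (1/4) ^ n * (1 + form \<phi> \<phi>)\<^sup>2" by (simp add: power_mult_distrib sq)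
      define b where "b = form (\<lambda>x. u x - w n x) \<phi>"
      have "b\<^sup>2 \<le> form (\<lambda>x. u x - w n x) (\<lambda>x. u x - w n x) * form \<phi> \<phi>"
        unfolding b_def by (intro form_Cauchy_Schwarz sob_diff u w \<phi>)
      also have "\<dots> \<le> 4 * (1/4) ^ n * form \<phi> \<phi>"
        by (intro mult_right_mono uw) auto
      finally have b: "b\<^sup>2 \<le> 4 * (1/4) ^ n * form \<phi> \<phi>" .
      have "form u \<phi> - L \<phi> = a + b"
        by (simp add: a_def b_def form_diff u w \<phi>)
      moreover have "(a + b)\<^sup>2 \<le> 2 * a\<^sup>2 + 2 * b\<^sup>2"
        using zero_le_power2[of "a - b"] by (simp add: power2_eq_square algebra_simps)
      ultimately show ?thesis using a b by simp
    qed
    moreover have "(\<lambda>n. 2 * ((1/4) ^ n * (1 + form \<phi> \<phi>)\<^sup>2) + 8 * ((1/4) ^ n * form \<phi> \<phi>)) \<longlonglongrightarrow> 0"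
      by (auto intro!: tendsto_eq_intros LIMSEQ_power_zero)
    ultimately have "(form u \<phi> - L \<phi>)\<^sup>2 \<le> 0"
      by (intro LIMSEQ_le_const[of _ 0 "(form u \<phi> - L \<phi>)\<^sup>2"]) auto
    then show ?thesis by simp
  qed
  then show thesis
    by (intro that[OF u]) (simp add: L_def)
qed

subsection \<open>Second differences\<close>

lemma integrable_sob:
  assumes "u \<in> sob"
  shows "integrable lborel u"
proof -
  have "integrable lborel (\<lambda>x. indicator \<Omega> x * u x)"
    by (rule integrable_mult_sob)
       (use assms emeasure_dom_finite in \<open>auto simp: power2_eq_square simp flip: indicator_inter_arith\<close>)
  moreover have "indicator \<Omega> x * u x = u x" for x
    by (cases "x \<in> \<Omega>") (simp_all add: sobD(2)[OF assms])
  ultimately show ?thesis by simp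
qed

text \<open>Away from the origin the kernel is integrable, so each first difference of a bounded
  function can be integrated separately before the two are paired.\<close>

definition trunc_kernel :: "real \<Rightarrow> 'a \<Rightarrow> real" where
  "trunc_kernel e h = (if e < norm h then frac_kernel s h else 0)"

lemma trunc_kernel_nonneg [simp]: "0 \<le> trunc_kernel e h"
  by (simp add: trunc_kernel_def)

lemma trunc_kernel_zero [simp]: "trunc_kernel e 0 = 0"
  by (simp add: trunc_kernel_def)

lemma trunc_kernel_minus [simp]: "trunc_kernel e (- h) = trunc_kernel e h"
  by (simp add: trunc_kernel_def)

lemma trunc_kernel_commute: "trunc_kernel e (x - y) = trunc_kernel e (y - x)"
  by (simp add: trunc_kernel_def norm_minus_commute frac_kernel_commute)

lemma trunc_kernel_measurable [measurable]: "trunc_kernel e \<in> borel_measurable borel"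
  unfolding trunc_kernel_def[abs_def] by measurable

lemma trunc_kernel_le:
  assumes "0 < e" "e \<le> 1"
  shows "trunc_kernel e h \<le> (min 1 ((norm h)\<^sup>2) * frac_kernel s h) / e\<^sup>2"
proof (cases "e < norm h")
  case True
  then have "e\<^sup>2 \<le> min 1 ((norm h)\<^sup>2)"
    using assms by (auto intro!: power_mono simp: power_le_one)
  then have "e\<^sup>2 * frac_kernel s h \<le> min 1 ((norm h)\<^sup>2) * frac_kernel s h"
    by (intro mult_right_mono) auto
  then show ?thesis
    using True assms by (simp add: trunc_kernel_def field_simps)
qed (use assms in \<open>simp add: trunc_kernel_def\<close>)

lemma integrable_trunc_kernel:
  assumes "0 < e" "e \<le> 1"
  shows "integrable lborel (trunc_kernel e)"
proof (rule Bochner_Integration.integrable_bound)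
  show "integrable lborel (\<lambda>h::'a. (min 1 ((norm h)\<^sup>2) * frac_kernel s h) / e\<^sup>2)"
    using integrable_frac_kernel[OF s_pos s_less_1, where 'a='a] by (intro integrable_divide_zero) simp
  show "AE h in lborel. norm (trunc_kernel e h) \<le> norm (min 1 ((norm h)\<^sup>2) * frac_kernel s h / e\<^sup>2)"
    using trunc_kernel_le[OF assms] by (auto simp: order_trans)
qed simp

lemma lborel_integral_reflect:
  fixes f :: "'a \<Rightarrow> real"
  assumes "f \<in> borel_measurable borel"
  shows "(\<integral>y. f (x - y) \<partial>lborel) = (\<integral>h. f h \<partial>lborel)"
  using integral_distr[of "\<lambda>y. x - y" lborel borel f] assms by (simp add: lborel_distr_reflect)

lemma lborel_integrable_reflect:
  fixes f :: "'a \<Rightarrow> real"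
  assumes "integrable lborel f"
  shows "integrable lborel (\<lambda>y. f (x - y))"
  using integrable_distr_eq[of "\<lambda>y. x - y" lborel borel f] assms
  by (simp add: lborel_distr_reflect)

text \<open>The truncation turns the form into an integral of second differences against \<open>\<phi>\<close>, which avoids
  principal values.\<close>

lemma truncated_form_le:
  assumes v: "v \<in> sob" and v_bounded: "\<And>x. \<bar>v x\<bar> \<le> M"
    and e: "0 < e" "e \<le> 1"
    and second: "\<And>x. x \<in> \<Omega> \<Longrightarrow>
      (\<integral>h. (2 * v x - v (x + h) - v (x - h)) * trunc_kernel e h \<partial>lborel) \<le> G x"
    and \<phi>: "\<phi> \<in> sob" "\<And>x. 0 \<le> \<phi> x" and G: "integrable lborel (\<lambda>x. G x * \<phi> x)"
  shows "(\<integral>p. trunc_kernel e (fst p - snd p) * (delta v p * delta \<phi> p) \<partial>(lborel \<Otimes>\<^sub>M lborel))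
    \<le> (\<integral>x. G x * \<phi> x \<partial>lborel)"
proof -
  have [measurable]: "v \<in> borel_measurable borel" "\<phi> \<in> borel_measurable borel"
    using v \<phi> by (auto simp: sob_def)
  let ?k = "trunc_kernel e"
  note k = integrable_trunc_kernel[OF e]
  have M: "0 \<le> M" using v_bounded[of 0] by simp
  have "integrable (lborel \<Otimes>\<^sub>M lborel) (\<lambda>p. \<phi> (fst p) * ?k (fst p - snd p))"
  proof (rule lborel_pair.Fubini_integrable)
    show "integrable lborel (\<lambda>x. \<integral>y. norm (\<phi> (fst (x, y)) * ?k (fst (x, y) - snd (x, y))) \<partial>lborel)"
      using integrable_sob[OF \<phi>(1)] by (simp add: abs_mult lborel_integral_reflect[of ?k])
    show "AE x in lborel. integrable lborel (\<lambda>y. \<phi> (fst (x, y)) * ?k (fst (x, y) - snd (x, y)))"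
      using lborel_integrable_reflect[OF k] by simp
  qed measurable
  then have majorant: "integrable (lborel \<Otimes>\<^sub>M lborel) (\<lambda>p. 2 * M * (\<phi> (fst p) * ?k (fst p - snd p)))"
    by simp
  \<comment> \<open>One half of the integrand: the product of the two differences is
    \<open>E (x, y) + E (y, x)\<close>, and both halves have the same integral by symmetry of the
    kernel.\<close>
  define E where "E p = (v (fst p) - v (snd p)) * \<phi> (fst p) * ?k (fst p - snd p)" for p
  have [measurable]: "E \<in> borel_measurable (borel \<Otimes>\<^sub>M borel)" unfolding E_def[abs_def] by measurable
  have diff_le: "\<bar>v x - v y\<bar> \<le> 2 * M" for x y
    using v_bounded[of x] v_bounded[of y] by linarith
  have E: "integrable (lborel \<Otimes>\<^sub>M lborel) E"
  proof (rule Bochner_Integration.integrable_bound[OF majorant])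
    show "AE p in lborel \<Otimes>\<^sub>M lborel. norm (E p) \<le> norm (2 * M * (\<phi> (fst p) * ?k (fst p - snd p)))"
    proof (intro AE_I2)
      fix p :: "'a \<times> 'a"
      have "\<bar>v (fst p) - v (snd p)\<bar> * (\<phi> (fst p) * ?k (fst p - snd p)) \<le> 2 * M * (\<phi> (fst p) * ?k (fst p - snd p))"
        by (rule mult_right_mono[OF diff_le]) (simp add: \<phi>(2))
      then show "norm (E p) \<le> norm (2 * M * (\<phi> (fst p) * ?k (fst p - snd p)))"
        using M \<phi>(2) by (simp add: E_def abs_mult mult.assoc)
    qed
  qed measurable
  have swap: "integrable (lborel \<Otimes>\<^sub>M lborel) (\<lambda>p. E (snd p, fst p))"
    "(\<integral>p. E (snd p, fst p) \<partial>(lborel \<Otimes>\<^sub>M lborel)) = (\<integral>p. E p \<partial>(lborel \<Otimes>\<^sub>M lborel))"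
    using lborel_pair.integrable_product_swap[OF E] lborel_pair.integral_product_swap[of E]
    by (simp_all add: case_prod_beta')
  have "(\<integral>p. ?k (fst p - snd p) * (delta v p * delta \<phi> p) \<partial>(lborel \<Otimes>\<^sub>M lborel))
      = (\<integral>p. E p + E (snd p, fst p) \<partial>(lborel \<Otimes>\<^sub>M lborel))"
    by (rule Bochner_Integration.integral_cong)
       (auto simp: E_def delta_def algebra_simps trunc_kernel_commute[of _ "snd _" "fst _"])
  also have "\<dots> = 2 * (\<integral>p. E p \<partial>(lborel \<Otimes>\<^sub>M lborel))"
    using E swap by simp
  also have "(\<integral>p. E p \<partial>(lborel \<Otimes>\<^sub>M lborel)) = (\<integral>x. \<integral>y. E (x, y) \<partial>lborel \<partial>lborel)"
    using lborel_pair.integral_fst'[OF E] by simp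
  also have "2 * \<dots> = (\<integral>x. 2 * (\<integral>y. E (x, y) \<partial>lborel) \<partial>lborel)" by simp
  also have "\<dots> \<le> (\<integral>x. G x * \<phi> x \<partial>lborel)"
  proof (rule integral_mono)
    show "integrable lborel (\<lambda>x. 2 * (\<integral>y. E (x, y) \<partial>lborel))"
      using lborel_pair.integrable_fst'[OF E] by simp
    fix x
    have bound: "integrable lborel (\<lambda>h. w h * ?k h)"
      if [measurable]: "w \<in> borel_measurable borel" and "\<And>h. \<bar>w h\<bar> \<le> 2 * M" for w :: "'a \<Rightarrow> real"
      by (rule Bochner_Integration.integrable_bound[OF integrable_mult_right[OF k, of "2 * M"]])
         (use that M in \<open>auto simp: abs_mult intro!: mult_right_mono\<close>)
    have i: "integrable lborel (\<lambda>h. (v x - v (x - h)) * ?k h)" "integrable lborel (\<lambda>h. (v x - v (x + h)) * ?k h)"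
      by (intro bound; use diff_le in auto)+
    have "(\<integral>y. E (x, y) \<partial>lborel) = (\<integral>y. \<phi> x * ((v x - v y) * ?k (x - y)) \<partial>lborel)"
      by (simp add: E_def mult_ac)
    also have "\<dots> = \<phi> x * (\<integral>y. (v x - v (x - (x - y))) * ?k (x - y) \<partial>lborel)"
      by simp
    also have "(\<integral>y. (v x - v (x - (x - y))) * ?k (x - y) \<partial>lborel) = (\<integral>h. (v x - v (x - h)) * ?k h \<partial>lborel)"
      by (rule lborel_integral_reflect) measurable
    finally have E1: "(\<integral>y. E (x, y) \<partial>lborel) = \<phi> x * (\<integral>h. (v x - v (x - h)) * ?k h \<partial>lborel)" .
    \<comment> \<open>Substituting \<open>- h\<close> for \<open>h\<close> in one of two equal
      copies turns their sum into the symmetric second difference. This is why twice the inner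
      integral of \<open>E\<close> is compared with \<open>G x * \<phi> x\<close>.\<close>
    have E2: "(\<integral>h. (v x - v (x - h)) * ?k h \<partial>lborel) = (\<integral>h. (v x - v (x + h)) * ?k h \<partial>lborel)"
      using lborel_integral_reflect[of "\<lambda>h. (v x - v (x - h)) * ?k h" 0] by simp
    have "2 * (\<integral>y. E (x, y) \<partial>lborel)
        = \<phi> x * ((\<integral>h. (v x - v (x - h)) * ?k h \<partial>lborel) + (\<integral>h. (v x - v (x + h)) * ?k h \<partial>lborel))"
      by (simp add: E1 E2)
    also have "(\<integral>h. (v x - v (x - h)) * ?k h \<partial>lborel) + (\<integral>h. (v x - v (x + h)) * ?k h \<partial>lborel)
        = (\<integral>h. (2 * v x - v (x + h) - v (x - h)) * ?k h \<partial>lborel)"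
      using i by (subst Bochner_Integration.integral_add[symmetric])
        (auto intro!: Bochner_Integration.integral_cong simp: algebra_simps)
    also have "\<phi> x * \<dots> \<le> \<phi> x * G x"
    proof (cases "x \<in> \<Omega>")
      case True
      then show ?thesis using second \<phi>(2) by (intro mult_left_mono) auto
    qed (simp add: sobD(2)[OF \<phi>(1)])
    finally show "2 * (\<integral>y. E (x, y) \<partial>lborel) \<le> G x * \<phi> x" by (simp add: mult.commute)
  qed (rule G)
  finally show ?thesis .
qed

text \<open>Let the truncation radius tend to zero. The integrand of the form is integrable and
  dominates all truncated ones, and on the diagonal everything is zero. Only a bound uniform in
  small \<open>e\<close> is asked of the second differences.\<close>

lemma form_le_of_second_difference:
  assumes v: "v \<in> sob" and v_bounded: "\<And>x. \<bar>v x\<bar> \<le> M" and \<rho>: "0 < \<rho>" "\<rho> \<le> 1"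
    and second: "\<And>e x. 0 < e \<Longrightarrow> e \<le> \<rho> \<Longrightarrow> x \<in> \<Omega> \<Longrightarrow>
      (\<integral>h. (2 * v x - v (x + h) - v (x - h)) * trunc_kernel e h \<partial>lborel) \<le> G x"
    and \<phi>: "\<phi> \<in> sob" "\<And>x. 0 \<le> \<phi> x" and G: "integrable lborel (\<lambda>x. G x * \<phi> x)"
  shows "form v \<phi> \<le> (\<integral>x. G x * \<phi> x \<partial>lborel)"
proof -
  have [measurable]: "v \<in> borel_measurable borel" "\<phi> \<in> borel_measurable borel"
    using v \<phi> by (auto simp: sob_def)
  let ?f = "\<lambda>p. frac_kernel s (fst p - snd p) * (delta v p * delta \<phi> p)"
  let ?g = "\<lambda>n p. trunc_kernel (\<rho> / real (Suc n)) (fst p - snd p) * (delta v p * delta \<phi> p)"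
  have f: "integrable (lborel \<Otimes>\<^sub>M lborel) ?f"
    using form_integrable[OF v \<phi>(1)] unfolding pair_meas_def
    by (subst (asm) integrable_density) auto
  have form: "form v \<phi> = (\<integral>p. ?f p \<partial>(lborel \<Otimes>\<^sub>M lborel))"
    unfolding form_def pair_meas_def by (subst integral_density) auto
  have "(\<lambda>n. \<integral>p. ?g n p \<partial>(lborel \<Otimes>\<^sub>M lborel)) \<longlonglongrightarrow> (\<integral>p. ?f p \<partial>(lborel \<Otimes>\<^sub>M lborel))"
  proof (rule integral_dominated_convergence[OF _ _ integrable_norm[OF f]])
    show "AE p in lborel \<Otimes>\<^sub>M lborel. (\<lambda>n. ?g n p) \<longlonglongrightarrow> ?f p"
    proof (intro AE_I2)
      fix p :: "'a \<times> 'a"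
      show "(\<lambda>n. ?g n p) \<longlonglongrightarrow> ?f p"
      proof (cases "fst p = snd p")
        case False
        have "(\<lambda>n. \<rho> / real (Suc n)) \<longlonglongrightarrow> 0"
          by (rule LIMSEQ_Suc) (rule lim_const_over_n)
        then have "\<forall>\<^sub>F n in sequentially. \<rho> / real (Suc n) < norm (fst p - snd p)"
          using False by (intro order_tendstoD(2)) auto
        then show ?thesis
          by (intro tendsto_eventually, elim eventually_mono) (simp add: trunc_kernel_def)
      qed simp
    qed
  qed (auto simp: trunc_kernel_def abs_mult)
  moreover have "(\<integral>p. ?g n p \<partial>(lborel \<Otimes>\<^sub>M lborel)) \<le> (\<integral>x. G x * \<phi> x \<partial>lborel)" for n
  proof -
    have "0 < \<rho> / real (Suc n)" "\<rho> / real (Suc n) \<le> \<rho>"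
      using \<rho> by (auto simp: field_simps)
    then show ?thesis
      using \<rho> by (intro truncated_form_le[OF v v_bounded _ _ second \<phi> G]) auto
  qed
  ultimately show ?thesis
    unfolding form by (intro LIMSEQ_le_const2) auto
qed

subsection \<open>A strict subsolution\<close>

text \<open>The quadratic sup-convolution of the squared distance to the complement. The squared
  distance itself has the wrong curvature, being an infimum of paraboloids with possible concave
  kinks; the supremum repairs this without enlarging the set of positivity.\<close>

definition bump :: "'a \<Rightarrow> real" where
  "bump x = (SUP z. (infdist z (- \<Omega>))\<^sup>2 - (norm (x - z))\<^sup>2)"

section \<open>Positivity, support, semiconvexity and Lipschitz bound of the barrier\<close>

lemma compl_dom_nonempty: "- \<Omega> \<noteq> {}"
proof
  assume "- \<Omega> = {}"
  then have "\<Omega> = UNIV" by auto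
  then show False using bounded_dom not_bounded_UNIV by auto
qed

lemma infdist_compl_bounded: "\<exists>R\<ge>0. \<forall>z. infdist z (- \<Omega>) \<le> R"
proof -
  obtain y where y: "y \<in> - \<Omega>" using compl_dom_nonempty by blast
  obtain R where R: "\<And>z. z \<in> \<Omega> \<Longrightarrow> dist y z \<le> R"
    using bounded_dom bounded_any_center[of \<Omega> y] by auto
  have "infdist z (- \<Omega>) \<le> max 0 R" for z
  proof (cases "z \<in> \<Omega>")
    case True
    then show ?thesis using infdist_le[OF y, of z] R[OF True] by (simp add: dist_commute)
  qed simp
  then show ?thesis by (intro exI[of _ "max 0 R"]) auto
qed

lemma bump_upper: "(infdist z (- \<Omega>))\<^sup>2 - (norm (x - z))\<^sup>2 \<le> bump x"
proof -
  obtain R where R: "\<And>z. infdist z (- \<Omega>) \<le> R" using infdist_compl_bounded by blast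
  have "(infdist z (- \<Omega>))\<^sup>2 - (norm (x - z))\<^sup>2 \<le> R\<^sup>2" for z
    using power_mono[OF R infdist_nonneg, of z 2] zero_le_power2[of "norm (x - z)"] by linarith
  then show ?thesis
    unfolding bump_def by (intro cSUP_upper) (auto intro!: bdd_aboveI[of _ "R\<^sup>2"])
qed

lemma bump_least: "(\<And>z. (infdist z (- \<Omega>))\<^sup>2 - (norm (x - z))\<^sup>2 \<le> c) \<Longrightarrow> bump x \<le> c"
  unfolding bump_def by (rule cSUP_least) auto

lemma bump_ge_infdist: "(infdist x (- \<Omega>))\<^sup>2 \<le> bump x"
  using bump_upper[of x x] by simp

lemma bump_nonneg: "0 \<le> bump x"
  using bump_ge_infdist[of x] zero_le_power2 order_trans by blast

lemma bump_pos:
  assumes "x \<in> \<Omega>"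
  shows "0 < bump x"
proof -
  have "0 < infdist x (- \<Omega>)"
    using assms open_dom compl_dom_nonempty by (intro infdist_pos_not_in_closed) auto
  then have "0 < (infdist x (- \<Omega>))\<^sup>2" by simp
  then show ?thesis using bump_ge_infdist[of x] by linarith
qed

text \<open>A point \<open>x\<close> outside \<Omega> competes in the infimum defining the distance
  of \<open>z\<close>, so no term of the supremum is positive. The equal coefficients of the two
  squares are what makes this exact.\<close>

lemma bump_outside:
  assumes "x \<notin> \<Omega>"
  shows "bump x = 0"
proof (rule antisym[OF bump_least bump_nonneg])
  fix z
  have "infdist z (- \<Omega>) \<le> norm (x - z)"
    using infdist_le[of x "- \<Omega>" z] assms by (simp add: dist_norm norm_minus_commute)
  then have "(infdist z (- \<Omega>))\<^sup>2 \<le> (norm (x - z))\<^sup>2"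
    by (intro power_mono infdist_nonneg)
  then show "(infdist z (- \<Omega>))\<^sup>2 - (norm (x - z))\<^sup>2 \<le> 0" by simp
qed

text \<open>\<open>bump x + (norm x)\<^sup>2\<close> is a supremum of affine functions, hence convex.\<close>

lemma bump_semiconvex: "2 * bump x \<le> bump (x + h) + bump (x - h) + 2 * (norm h)\<^sup>2"
proof -
  have "bump x \<le> (bump (x + h) + bump (x - h) + 2 * (norm h)\<^sup>2) / 2"
  proof (rule bump_least)
    fix z
    have "(norm (x + h - z))\<^sup>2 + (norm (x - h - z))\<^sup>2 = 2 * (norm (x - z))\<^sup>2 + 2 * (norm h)\<^sup>2"
      by (simp add: power2_norm_eq_inner inner_simps algebra_simps)
    then show "(infdist z (- \<Omega>))\<^sup>2 - (norm (x - z))\<^sup>2 \<le> (bump (x + h) + bump (x - h) + 2 * (norm h)\<^sup>2) / 2"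
      using bump_upper[of z "x + h"] bump_upper[of z "x - h"] by simp
  qed
  then show ?thesis by simp
qed

text \<open>Centres \<open>z\<close> with \<open>norm (x - z) > R\<close> give nonpositive terms, so
  moving \<open>x\<close> changes only paraboloids of slope about \<open>2 * R\<close>. For points
  more than 1 apart the bound \<open>R\<^sup>2\<close> on the values suffices.\<close>

lemma bump_bounded_lipschitz: "\<exists>M L. 0 \<le> M \<and> (\<forall>x. bump x \<le> M) \<and> L-lipschitz_on UNIV bump"
proof -
  obtain R where "0 \<le> R" and R: "\<And>z. infdist z (- \<Omega>) \<le> R" using infdist_compl_bounded by blast
  have R2: "(infdist z (- \<Omega>))\<^sup>2 \<le> R\<^sup>2" for z
    using R infdist_nonneg by (intro power_mono)
  have le: "bump x \<le> R\<^sup>2" for x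
  proof (rule bump_least)
    show "(infdist z (- \<Omega>))\<^sup>2 - (norm (x - z))\<^sup>2 \<le> R\<^sup>2" for z
      using R2[of z] zero_le_power2[of "norm (x - z)"] by linarith
  qed
  have near: "bump x \<le> bump y + norm (x - y) * (2 * R + norm (x - y))" for x y
  proof (rule bump_least)
    fix z
    let ?t = "norm (x - y)"
    show "(infdist z (- \<Omega>))\<^sup>2 - (norm (x - z))\<^sup>2 \<le> bump y + ?t * (2 * R + ?t)"
    proof (cases "norm (x - z) \<le> R")
      case True
      have "norm (y - z) \<le> norm (x - z) + ?t"
        using norm_triangle_ineq[of "y - x" "x - z"] by (simp add: norm_minus_commute)
      then have "(norm (y - z))\<^sup>2 \<le> (norm (x - z) + ?t)\<^sup>2" by (intro power_mono) auto
      also have "\<dots> = (norm (x - z))\<^sup>2 + ?t * (2 * norm (x - z) + ?t)"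
        by (simp add: power2_eq_square algebra_simps)
      also have "\<dots> \<le> (norm (x - z))\<^sup>2 + ?t * (2 * R + ?t)"
        using True by (intro add_left_mono mult_left_mono) auto
      finally show ?thesis using bump_upper[of z y] by linarith
    next
      case False
      then have "R\<^sup>2 \<le> (norm (x - z))\<^sup>2" using \<open>0 \<le> R\<close> by (intro power_mono) auto
      moreover have "0 \<le> ?t * (2 * R + ?t)" using \<open>0 \<le> R\<close> by simp
      ultimately show ?thesis using R2[of z] bump_nonneg[of y] by linarith
    qed
  qed
  let ?L = "2 * R + 1 + R\<^sup>2"
  have half: "bump x - bump y \<le> ?L * norm (x - y)" for x y
  proof (cases "norm (x - y) \<le> 1")
    case True
    then have "norm (x - y) * (2 * R + norm (x - y)) \<le> norm (x - y) * ?L"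
      by (intro mult_left_mono) (auto intro: add_increasing2)
    then show ?thesis using near[of x y] by (simp add: mult.commute)
  next
    case False
    have "bump x - bump y \<le> R\<^sup>2" using le[of x] bump_nonneg[of y] by linarith
    also have "\<dots> \<le> ?L * 1" using \<open>0 \<le> R\<close> by simp
    also have "\<dots> \<le> ?L * norm (x - y)" using False \<open>0 \<le> R\<close> by (intro mult_left_mono) auto
    finally show ?thesis .
  qed
  have "?L-lipschitz_on UNIV bump"
  proof (rule lipschitz_onI)
    fix x y
    show "dist (bump x) (bump y) \<le> ?L * dist x y"
      using half[of x y] half[of y x] by (simp add: dist_norm norm_minus_commute abs_le_iff)
  qed (use \<open>0 \<le> R\<close> in auto)
  then show ?thesis using le by (intro exI[of _ "R\<^sup>2"] exI[of _ ?L]) auto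
qed

lemma bump_sob: "bump \<in> sob"
  using bump_bounded_lipschitz bump_nonneg by (auto intro!: lipschitz_in_sob simp: bump_outside)

lemma frac_kernel_lower: "\<exists>\<kappa>>0. \<forall>x\<in>\<Omega>. \<forall>y\<in>\<Omega>. x \<noteq> y \<longrightarrow> \<kappa> \<le> frac_kernel s (x - y)"
proof -
  obtain R where R: "0 < R" "\<And>x. x \<in> \<Omega> \<Longrightarrow> norm x \<le> R"
    using bounded_dom by (auto simp: bounded_pos)
  have "1 / (2 * R) powr (real DIM('a) + 2 * s) \<le> frac_kernel s (x - y)"
    if "x \<in> \<Omega>" "y \<in> \<Omega>" "x \<noteq> y" for x y
  proof -
    have "norm (x - y) \<le> 2 * R" "0 < norm (x - y)"
      using R(2)[OF that(1)] R(2)[OF that(2)] norm_triangle_ineq4[of x y] that by auto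
    then show ?thesis
      unfolding frac_kernel_def using s_pos
      by (intro divide_left_mono powr_mono2 mult_pos_pos) auto
  qed
  then show ?thesis
    using R by (intro exI[of _ "1 / (2 * R) powr (real DIM('a) + 2 * s)"]) auto
qed

text \<open>Absolute continuity of the integral: the balls shrink to a null point. It makes the
  near-field error in \<open>subsolution_profile\<close> as small as desired.\<close>

lemma integral_small_ball:
  fixes g :: "'a \<Rightarrow> real"
  assumes g: "integrable lborel g" and "0 < c"
  shows "\<exists>\<rho>>0. \<rho> \<le> 1 \<and> (\<integral>h. indicator (cball 0 \<rho>) h * g h \<partial>lborel) \<le> c"
proof -
  have [measurable]: "g \<in> borel_measurable borel" using g by simp
  have "(\<lambda>n. \<integral>h. indicator (cball 0 (1 / real (Suc n))) h * g h \<partial>lborel) \<longlonglongrightarrow> (\<integral>h. 0 \<partial>(lborel :: 'a measure))"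
  proof (rule integral_dominated_convergence[OF _ _ integrable_norm[OF g]])
    show "AE h in lborel. (\<lambda>n. indicator (cball 0 (1 / real (Suc n))) h * g h) \<longlonglongrightarrow> 0"
      using AE_lborel_singleton[of "0::'a"]
    proof eventually_elim
      fix h :: 'a assume "h \<noteq> 0"
      have "(\<lambda>n. 1 / real (Suc n)) \<longlonglongrightarrow> 0"
        by (rule LIMSEQ_Suc) (rule lim_const_over_n)
      then have "\<forall>\<^sub>F n in sequentially. 1 / real (Suc n) < norm h"
        using \<open>h \<noteq> 0\<close> by (intro order_tendstoD(2)) auto
      then show "(\<lambda>n. indicator (cball 0 (1 / real (Suc n))) h * g h) \<longlonglongrightarrow> 0"
        by (intro tendsto_eventually, elim eventually_mono) (simp add: indicator_def)
    qed
  qed (auto simp: indicator_def)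
  then have "\<forall>\<^sub>F n in sequentially. (\<integral>h. indicator (cball 0 (1 / real (Suc n))) h * g h \<partial>lborel) < c"
    using \<open>0 < c\<close> by (intro order_tendstoD(2)) auto
  then obtain n where "(\<integral>h. indicator (cball 0 (1 / real (Suc n))) h * g h \<partial>lborel) < c"
    by (auto simp: eventually_sequentially)
  then show ?thesis by (intro exI[of _ "1 / real (Suc n)"]) auto
qed

text \<open>Where \<open>v\<close> vanishes, the fractional Laplacian of a nonnegative nontrivial \<open>v\<close> is negative; this
  strict negativity persists where \<open>v\<close> is small, up to the boundary.\<close>

theorem subsolution_profile:
  "\<exists>v \<delta> c C. v \<in> sob \<and> (\<forall>x. 0 \<le> v x) \<and> (\<forall>x\<in>\<Omega>. 0 < v x) \<and> 0 < \<delta> \<and> 0 < c \<and> 0 < C \<and>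
    (\<forall>\<phi>\<in>sob. (\<forall>x. 0 \<le> \<phi> x) \<longrightarrow> form v \<phi> \<le> (\<integral>x. (if v x \<le> \<delta> then - c else C) * \<phi> x \<partial>lborel))"
proof -
  let ?v = bump
  let ?m = "\<lambda>h::'a. min 1 ((norm h)\<^sup>2) * frac_kernel s h"
  obtain M where "0 \<le> M" and M: "\<And>x. ?v x \<le> M" using bump_bounded_lipschitz by blast
  have [measurable]: "?v \<in> borel_measurable borel" using bump_sob by (rule sobD)
  note m = integrable_frac_kernel[OF s_pos s_less_1, where 'a='a]
  define I where "I = (\<integral>h. ?m h \<partial>lborel)"
  have I: "0 \<le> I" unfolding I_def by (rule Bochner_Integration.integral_nonneg) simp
  obtain \<kappa> where \<kappa>: "0 < \<kappa>" "\<And>x y. x \<in> \<Omega> \<Longrightarrow> y \<in> \<Omega> \<Longrightarrow> x \<noteq> y \<Longrightarrow> \<kappa> \<le> frac_kernel s (x - y)"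
    using frac_kernel_lower by blast
  obtain z0 where z0: "z0 \<in> \<Omega>" using dom_nonempty by blast
  \<comment> \<open>Half the distance, so that every point of \<open>ball z0 r0\<close> still has
    distance at least \<open>r0\<close> from the complement.\<close>
  define r0 where "r0 = infdist z0 (- \<Omega>) / 2"
  have r0: "0 < r0"
    unfolding r0_def using z0 open_dom compl_dom_nonempty infdist_pos_not_in_closed[of "- \<Omega>" z0] by auto
  have ball: "y \<in> \<Omega>" "r0\<^sup>2 \<le> ?v y" if "y \<in> ball z0 r0" for y
  proof -
    have "infdist z0 (- \<Omega>) \<le> infdist y (- \<Omega>) + dist z0 y" by (rule infdist_triangle)
    then have *: "r0 \<le> infdist y (- \<Omega>)" using that by (simp add: r0_def)
    show "y \<in> \<Omega>"
    proof (rule ccontr)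
      assume "y \<notin> \<Omega>"
      then have "infdist y (- \<Omega>) = 0" by simp
      then show False using * r0 by linarith
    qed
    show "r0\<^sup>2 \<le> ?v y"
      using bump_ge_infdist[of y] power_mono[OF *, of 2] r0 by simp
  qed
  \<comment> \<open>When \<open>x + h\<close> lies in \<open>ball z0 r0\<close>, the product
    \<open>bump (x + h) * frac_kernel s h\<close> is at least \<open>b\<close>; over the whole ball
    this is a gain of \<open>b * B\<close>.\<close>
  define b where "b = r0\<^sup>2 * \<kappa>"
  have b: "0 < b" using r0 \<kappa> by (simp add: b_def)
  define B where "B = measure lborel (ball (0::'a) r0)"
  have B: "0 < B" unfolding B_def using r0 by (rule content_ball_pos)
  have B_shift: "measure lborel (ball z r0) = B" for z :: 'a
    unfolding B_def using r0 by (simp add: content_ball_conv_unit_ball[of r0])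
  have ball_int: "integrable lborel (indicator (ball z r0) :: 'a \<Rightarrow> real)" for z
    using emeasure_lborel_ball_finite[of z r0] by simp
  \<comment> \<open>The first term is the near-field loss allowed by semiconvexity. The second pays
    for the part of the gain that falls inside \<open>cball 0 \<rho>\<close>, so that the full
    \<open>b * B\<close> can be subtracted for every \<open>x\<close>.\<close>
  define g where "g h = 2 * ?m h + b * indicator (cball 0 1) h" for h :: 'a
  have g: "integrable lborel g"
    unfolding g_def[abs_def] using m emeasure_lborel_cball_finite[of "0::'a" 1]
    by (intro Bochner_Integration.integrable_add integrable_mult_right) auto
  obtain \<rho> where \<rho>: "0 < \<rho>" "\<rho> \<le> 1" "(\<integral>h. indicator (cball 0 \<rho>) h * g h \<partial>lborel) \<le> b * B / 4"
    using integral_small_ball[OF g, of "b * B / 4"] b B by auto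
  \<comment> \<open>Makes the far-field loss from \<open>2 * bump x \<le> 2 * \<delta>\<close> at
    most \<open>b * B / 4\<close>. The near field costs at most another \<open>b * B / 4\<close>,
    leaving \<open>c = b * B / 2\<close>.\<close>
  define \<delta> where "\<delta> = \<rho>\<^sup>2 * (b * B) / (8 * (I + 1))"
  have \<delta>: "0 < \<delta>" unfolding \<delta>_def using \<rho> b B I by (intro divide_pos_pos mult_pos_pos) auto
  have \<delta>_I: "2 * \<delta> / \<rho>\<^sup>2 * I \<le> b * B / 4"
  proof -
    have "2 * \<delta> / \<rho>\<^sup>2 * I = b * B / 4 * (I / (I + 1))"
    proof -
      have "\<rho>\<^sup>2 * X / (8 * Y) * 2 / \<rho>\<^sup>2 * Z = X / 4 * (Z / Y)" for X Y Z :: real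
        using \<rho>(1) by (cases "Y = 0") (simp_all add: field_simps)
      from this[of "b * B" "I + 1" I] show ?thesis by (simp add: \<delta>_def mult.commute[of 2])
    qed
    also have "\<dots> \<le> b * B / 4 * 1"
      using I b B by (intro mult_left_mono) auto
    finally show ?thesis by simp
  qed
  define c where "c = b * B / 2"
  \<comment> \<open>For small \<open>h\<close> semiconvexity bounds the second difference by
    \<open>2 * (norm h)\<^sup>2\<close>, for large \<open>h\<close> it is at most
    \<open>2 * M\<close>; the added 1 makes \<open>C\<close> positive.\<close>
  define C where "C = (2 + 2 * M) * I + 1"
  have c: "0 < c" using b B by (simp add: c_def)
  have C: "0 < C" using I \<open>0 \<le> M\<close> by (auto simp: C_def intro: add_nonneg_pos)
  define G where "G x = (if ?v x \<le> \<delta> then - c else C)" for x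
  have [measurable]: "G \<in> borel_measurable borel" unfolding G_def[abs_def] by measurable
  have second: "(\<integral>h. (2 * ?v x - ?v (x + h) - ?v (x - h)) * trunc_kernel e h \<partial>lborel) \<le> G x"
    if e: "0 < e" "e \<le> \<rho>" and x: "x \<in> \<Omega>" for e x
  proof -
    let ?d = "\<lambda>h. 2 * ?v x - ?v (x + h) - ?v (x - h)"
    let ?T = "\<lambda>h. ?d h * trunc_kernel e h"
    have d1: "?d h \<le> 2 * (norm h)\<^sup>2" for h
      using bump_semiconvex[of x h] by linarith
    have d2: "?d h \<le> 2 * ?v x - ?v (x + h)" for h using bump_nonneg[of "x - h"] by linarith
    have "\<bar>?d h\<bar> \<le> 4 * M" for h
      using M[of x] M[of "x + h"] M[of "x - h"] bump_nonneg[of x] bump_nonneg[of "x + h"] bump_nonneg[of "x - h"] \<open>0 \<le> M\<close>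
      by linarith
    then have T: "integrable lborel ?T"
      using e \<rho> \<open>0 \<le> M\<close>
      by (intro Bochner_Integration.integrable_bound[OF integrable_mult_right[OF integrable_trunc_kernel[of e], of "4 * M"]])
         (auto simp: abs_mult intro!: mult_right_mono)
    show ?thesis
    proof (cases "?v x \<le> \<delta>")
      case False
      have "?T h \<le> (2 + 2 * M) * ?m h" for h
      proof (cases "e < norm h")
        case True
        have "?d h \<le> 2 * M" using d2[of h] M[of x] bump_nonneg[of "x + h"] by linarith
        moreover have "2 * (norm h)\<^sup>2 \<le> (2 + 2 * M) * (norm h)\<^sup>2"
          using \<open>0 \<le> M\<close> by (intro mult_right_mono) auto
        ultimately have "?d h \<le> (2 + 2 * M) * min 1 ((norm h)\<^sup>2)"
          using d1[of h] unfolding min_def by (cases "1 \<le> (norm h)\<^sup>2") auto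
        then have "?d h * frac_kernel s h \<le> (2 + 2 * M) * min 1 ((norm h)\<^sup>2) * frac_kernel s h"
          by (rule mult_right_mono) simp
        then show ?thesis using True by (simp add: trunc_kernel_def mult.assoc)
      next
        case False
        then show ?thesis using \<open>0 \<le> M\<close> by (simp add: trunc_kernel_def)
      qed
      then have "(\<integral>h. ?T h \<partial>lborel) \<le> (\<integral>h. (2 + 2 * M) * ?m h \<partial>lborel)"
        by (intro integral_mono T integrable_mult_right m)
      then show ?thesis using False by (simp add: G_def C_def I_def)
    next
      case True
      let ?U = "\<lambda>h. indicator (cball 0 \<rho>) h * g h + 2 * \<delta> / \<rho>\<^sup>2 * ?m h - b * indicator (ball (z0 - x) r0) h"
      have i: "integrable lborel (\<lambda>h. indicator (cball 0 \<rho>) h * g h)"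
        by (rule Bochner_Integration.integrable_bound[OF g]) (use g in \<open>auto simp: indicator_def\<close>)
      have "?T h \<le> ?U h" for h
      proof (cases "norm h \<le> \<rho>")
        case True
        have "?T h \<le> 2 * ?m h"
        proof (cases "e < norm h")
          case e: True
          have "(norm h)\<^sup>2 \<le> 1" using True \<rho> by (auto intro: power_le_one)
          then show ?thesis
            using e mult_right_mono[OF d1 frac_kernel_nonneg, of h s h] by (simp add: trunc_kernel_def)
        qed (simp add: trunc_kernel_def)
        moreover have "indicator (cball 0 \<rho>) h * g h = 2 * ?m h + b"
          using True \<rho> by (simp add: g_def)
        moreover have "0 \<le> 2 * \<delta> / \<rho>\<^sup>2 * ?m h" using \<delta> by simp
        moreover have "b * indicator (ball (z0 - x) r0) h \<le> b" using b by (simp add: indicator_def)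
        ultimately show ?thesis by linarith
      next
        case far: False
        then have "e < norm h" using e by simp
        have "?d h \<le> 2 * \<delta> - ?v (x + h)" using d2[of h] True by simp
        from mult_right_mono[OF this frac_kernel_nonneg[of s h]]
        have 1: "?T h \<le> 2 * \<delta> * frac_kernel s h - ?v (x + h) * frac_kernel s h"
          using \<open>e < norm h\<close> by (simp add: trunc_kernel_def left_diff_distrib)
        have 2: "2 * \<delta> * frac_kernel s h \<le> 2 * \<delta> * (?m h / \<rho>\<^sup>2)"
          using trunc_kernel_le[OF \<rho>(1,2), of h] far \<delta>
          by (intro mult_left_mono) (auto simp: trunc_kernel_def)
        have 3: "b * indicator (ball (z0 - x) r0) h \<le> ?v (x + h) * frac_kernel s h"
        proof (cases "h \<in> ball (z0 - x) r0")
          case True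
          then have xh: "x + h \<in> ball z0 r0" by (simp add: dist_norm algebra_simps)
          have "h \<noteq> 0" using far \<rho> by auto
          then have "\<kappa> \<le> frac_kernel s h"
            using \<kappa>(2)[OF ball(1)[OF xh] x] by simp
          then have "r0\<^sup>2 * \<kappa> \<le> ?v (x + h) * frac_kernel s h"
            using ball(2)[OF xh] \<kappa>(1) bump_nonneg by (intro mult_mono) auto
          then show ?thesis using True by (simp add: b_def)
        qed (simp add: bump_nonneg)
        have "?U h = 2 * \<delta> * (?m h / \<rho>\<^sup>2) - b * indicator (ball (z0 - x) r0) h"
          using far by simp
        then show ?thesis using 1 2 3 by linarith
      qed
      then have "(\<integral>h. ?T h \<partial>lborel) \<le> (\<integral>h. ?U h \<partial>lborel)"
        by (intro integral_mono T Bochner_Integration.integrable_diff Bochner_Integration.integrable_add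
            integrable_mult_right m i ball_int)
      also have "\<dots> = (\<integral>h. indicator (cball 0 \<rho>) h * g h \<partial>lborel) + 2 * \<delta> / \<rho>\<^sup>2 * I - b * B"
        using i m ball_int by (simp add: I_def B_shift)
      also have "\<dots> \<le> - c" using \<rho>(3) \<delta>_I unfolding c_def by argo
      finally show ?thesis using True by (simp add: G_def)
    qed
  qed
  have "form ?v \<phi> \<le> (\<integral>x. G x * \<phi> x \<partial>lborel)" if \<phi>: "\<phi> \<in> sob" "\<forall>x. 0 \<le> \<phi> x" for \<phi>
  proof (rule form_le_of_second_difference[OF bump_sob _ \<rho>(1,2) second \<phi>(1)])
    have [measurable]: "\<phi> \<in> borel_measurable borel" using \<phi>(1) by (rule sobD)
    show "integrable lborel (\<lambda>x. G x * \<phi> x)"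
    proof (rule Bochner_Integration.integrable_bound[OF integrable_mult_right[OF integrable_sob[OF \<phi>(1)], of "c + C"]])
      have "\<bar>G x\<bar> \<le> \<bar>c + C\<bar>" for x using c C by (simp add: G_def)
      then show "AE x in lborel. norm (G x * \<phi> x) \<le> norm ((c + C) * \<phi> x)"
        by (auto simp: abs_mult intro!: mult_right_mono)
    qed measurable
    show "\<bar>?v x\<bar> \<le> M" for x using M bump_nonneg by simp
  qed (use \<phi> in auto)
  then show ?thesis
    using bump_sob bump_nonneg bump_pos \<delta> c C unfolding G_def by blast
qed

end

subsection \<open>Monotone iteration\<close>

text \<open>Here \<open>a\<close> plays the role of the normalising constant \<open>C\<^bsub>N,s\<^esub>\<close>, which \<open>form\<close> omits,
  and \<open>l\<close> that of \<open>\<lambda>\<close>.\<close>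

locale sublinear_problem = frac_domain \<Omega> s
  for \<Omega> :: "'a::euclidean_space set" and s :: real +
  fixes q a l :: real
  assumes q_pos: "0 < q" and q_less_1: "q < 1" and a_pos: "0 < a" and l_pos: "0 < l"
begin

text \<open>The indicator matters for square integrability: where \<open>w\<close> vanishes outside
  \<Omega>, the bracket is \<open>0 powr q - 1 = - 1\<close>.\<close>

definition rhs :: "('a \<Rightarrow> real) \<Rightarrow> 'a \<Rightarrow> real" where
  "rhs w x = indicator \<Omega> x * (w x powr q - 1)"

definition subsolution :: "('a \<Rightarrow> real) \<Rightarrow> bool" where
  "subsolution w \<longleftrightarrow> w \<in> sob \<and> (\<forall>x. 0 \<le> w x) \<and>
     (\<forall>\<phi>\<in>sob. (\<forall>x. 0 \<le> \<phi> x) \<longrightarrow> a * form w \<phi> \<le> l * (\<integral>x. rhs w x * \<phi> x \<partial>lborel))"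

section \<open>Monotonicity, growth and integrability of the nonlinearity\<close>

lemma rhs_measurable [measurable (raw)]:
  assumes [measurable]: "w \<in> borel_measurable borel"
  shows "rhs w \<in> borel_measurable borel"
  unfolding rhs_def[abs_def] by measurable

lemma rhs_mono: "0 \<le> w x \<Longrightarrow> w x \<le> u x \<Longrightarrow> rhs w x \<le> rhs u x"
  using q_pos by (auto simp: rhs_def intro!: mult_left_mono powr_mono2)

lemma rhs_bound:
  assumes "0 \<le> w x"
  shows "\<bar>rhs w x\<bar> \<le> indicator \<Omega> x * (1 + w x)"
proof -
  have "\<bar>w x powr q - 1\<bar> \<le> 1 + w x"
    using powr_le_one_plus[OF assms q_pos q_less_1] powr_ge_zero[of "w x" q] assms by linarith
  then show ?thesis by (simp add: rhs_def abs_mult indicator_def)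
qed

lemma one_plus_square_integrable:
  fixes w :: "'a \<Rightarrow> real"
  assumes "w \<in> borel_measurable borel" and w: "integrable lborel (\<lambda>x. (w x)\<^sup>2)"
  shows "integrable lborel (\<lambda>x. (indicator \<Omega> x * (1 + w x))\<^sup>2)"
proof -
  have [measurable]: "w \<in> borel_measurable borel" by fact
  have int: "integrable lborel (\<lambda>x. 2 * indicator \<Omega> x + 2 * (w x)\<^sup>2)"
    using w emeasure_dom_finite by simp
  have "(1 + t)\<^sup>2 \<le> 2 + 2 * t\<^sup>2" for t :: real
    using zero_le_power2[of "1 - t"] by (simp add: power2_eq_square algebra_simps)
  then have "AE x in lborel. norm ((indicator \<Omega> x * (1 + w x))\<^sup>2) \<le> norm (2 * indicator \<Omega> x + 2 * (w x)\<^sup>2)"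
    by (auto simp: indicator_def)
  then show ?thesis
    by (intro Bochner_Integration.integrable_bound[OF int]) measurable
qed

lemma rhs_square_integrable:
  assumes "w \<in> borel_measurable borel" "integrable lborel (\<lambda>x. (w x)\<^sup>2)" "\<And>x. 0 \<le> w x"
  shows "integrable lborel (\<lambda>x. (rhs w x)\<^sup>2)"
proof (rule Bochner_Integration.integrable_bound[OF one_plus_square_integrable[OF assms(1,2)]])
  have "\<bar>rhs w x\<bar>\<^sup>2 \<le> (indicator \<Omega> x * (1 + w x))\<^sup>2" for x
    using rhs_bound[of w x] assms(3) by (intro power_mono) auto
  then show "AE x in lborel. norm ((rhs w x)\<^sup>2) \<le> norm ((indicator \<Omega> x * (1 + w x))\<^sup>2)"
    by simp
qed (use assms in measurable)

lemma rhs_integrable: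
  assumes "w \<in> sob" "\<And>x. 0 \<le> w x" "\<phi> \<in> sob"
  shows "integrable lborel (\<lambda>x. rhs w x * \<phi> x)"
  using assms sobD(1)[OF assms(1)] sob_square_integrable[OF assms(1)]
  by (intro integrable_mult_sob rhs_square_integrable rhs_measurable)

text \<open>Solve the linear problem with data \<open>rhs w\<close> and test the difference with the
  positive part of \<open>w - u0\<close>: its energy vanishes. Since \<open>rhs\<close> is
  increasing, the new function, which lies above \<open>w\<close>, is again a subsolution.\<close>

lemma monotone_step:
  assumes w: "subsolution w"
  shows "\<exists>u. subsolution u \<and> (\<forall>x. w x \<le> u x) \<and>
    (\<forall>\<phi>\<in>sob. a * form u \<phi> = l * (\<integral>x. rhs w x * \<phi> x \<partial>lborel))"
proof -
  have w_sob: "w \<in> sob" and w_nonneg: "\<And>x. 0 \<le> w x"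
    and w_sub: "\<And>\<phi>. \<phi> \<in> sob \<Longrightarrow> (\<And>x. 0 \<le> \<phi> x) \<Longrightarrow> a * form w \<phi> \<le> l * (\<integral>x. rhs w x * \<phi> x \<partial>lborel)"
    using w by (auto simp: subsolution_def)
  have [measurable]: "w \<in> borel_measurable borel" using w_sob by (rule sobD)
  have sq: "integrable lborel (\<lambda>x. (rhs w x)\<^sup>2)"
    using sob_square_integrable[OF w_sob] w_nonneg by (intro rhs_square_integrable) auto
  obtain u where u: "u \<in> sob" "\<And>\<phi>. \<phi> \<in> sob \<Longrightarrow> form u \<phi> = (\<integral>x. rhs w x * \<phi> x \<partial>lborel)"
    using Riesz_representation[OF _ sq] by auto
  define u0 where "u0 x = l / a * u x" for x
  have u0: "u0 \<in> sob" "\<And>\<phi>. \<phi> \<in> sob \<Longrightarrow> a * form u0 \<phi> = l * (\<integral>x. rhs w x * \<phi> x \<partial>lborel)"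
    unfolding u0_def[abs_def]
    using sob_cmult[OF u(1), of "l / a"] form_cmult[OF u(1), of _ "l / a"] u(2) a_pos by simp_all
  define z where "z x = max 0 (w x - u0 x)" for x
  have z: "z \<in> sob" "form z z \<le> form (\<lambda>x. w x - u0 x) z"
    using sob_positive_part[OF sob_diff[OF w_sob u0(1)]] by (simp_all add: z_def[abs_def])
  have "a * form z z \<le> a * (form w z - form u0 z)"
    using z a_pos by (simp add: form_diff w_sob u0)
  also have "\<dots> \<le> 0"
    using w_sub[of z] u0(2)[of z] z(1) by (simp add: z_def right_diff_distrib)
  finally have zz: "form z z = 0"
    using a_pos form_nonneg[of z] by (simp add: mult_le_0_iff)
  have z_form: "form z \<phi> = 0" if "\<phi> \<in> sob" for \<phi>
    using form_Cauchy_Schwarz[OF z(1) that] by (simp add: zz)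
  \<comment> \<open>The function \<open>u1\<close> is the pointwise maximum of \<open>u0\<close> and
    \<open>w\<close>. The correction \<open>z\<close> has zero energy, so it leaves the equation
    intact while giving \<open>w x \<le> u1 x\<close> at every point.\<close>
  define u1 where "u1 x = u0 x + z x" for x
  have u1_sob: "u1 \<in> sob" unfolding u1_def[abs_def] using u0 z by (intro sob_add)
  have u1_form: "a * form u1 \<phi> = l * (\<integral>x. rhs w x * \<phi> x \<partial>lborel)" if "\<phi> \<in> sob" for \<phi>
    unfolding u1_def[abs_def] using that u0 z by (simp add: form_add z_form)
  have w_le: "w x \<le> u1 x" for x by (simp add: u1_def z_def)
  have u1_nonneg: "0 \<le> u1 x" for x using w_le w_nonneg order_trans by blast
  have "a * form u1 \<phi> \<le> l * (\<integral>x. rhs u1 x * \<phi> x \<partial>lborel)"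
    if "\<phi> \<in> sob" "\<forall>x. 0 \<le> \<phi> x" for \<phi>
    unfolding u1_form[OF that(1)]
    using l_pos that w_le w_nonneg u1_nonneg
    by (intro mult_left_mono integral_mono rhs_integrable mult_right_mono rhs_mono w_sob u1_sob) auto
  then show ?thesis
    using u1_sob u1_form w_le u1_nonneg unfolding subsolution_def by blast
qed

text \<open>Test with \<open>u\<close> itself: \<open>w powr q - 1 \<le> u powr q\<close>, and
  sublinearity makes the right-hand side a small multiple of the squared L2 norm plus a constant.
  The bound is the same for all iterates.\<close>

lemma solution_energy_bound:
  "\<exists>E. \<forall>w u. w \<in> sob \<longrightarrow> u \<in> sob \<longrightarrow> (\<forall>x. 0 \<le> w x \<and> w x \<le> u x) \<longrightarrow>
     (\<forall>\<phi>\<in>sob. a * form u \<phi> = l * (\<integral>x. rhs w x * \<phi> x \<partial>lborel)) \<longrightarrow> form u u \<le> E"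
proof -
  obtain P where "0 < P" and P: "\<And>u. u \<in> sob \<Longrightarrow> (\<integral>x. (u x)\<^sup>2 \<partial>lborel) \<le> P * form u u"
    using Poincare by blast
  \<comment> \<open>Chosen so that, after Poincare, the quadratic term is exactly half of
    \<open>a * form u u\<close> and can be absorbed.\<close>
  define \<eta> where "\<eta> = a / (2 * l * P)"
  have \<eta>: "0 < \<eta>" using a_pos l_pos \<open>0 < P\<close> by (simp add: \<eta>_def)
  obtain K where "0 \<le> K" and K: "\<And>t. 0 \<le> t \<Longrightarrow> t powr q * t \<le> \<eta> * t\<^sup>2 + K"
    using sublinear_young[OF q_pos q_less_1 \<eta>] by blast
  define V where "V = measure lborel \<Omega>"
  have "form u u \<le> 2 * l * K * V / a"
    if w: "w \<in> sob" and u: "u \<in> sob" and le: "\<forall>x. 0 \<le> w x \<and> w x \<le> u x"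
      and eq: "\<forall>\<phi>\<in>sob. a * form u \<phi> = l * (\<integral>x. rhs w x * \<phi> x \<partial>lborel)" for w u
  proof -
    have nonneg: "0 \<le> u x" for x using le order_trans by blast
    have "(\<integral>x. rhs w x * u x \<partial>lborel) \<le> (\<integral>x. \<eta> * (u x)\<^sup>2 + K * indicator \<Omega> x \<partial>lborel)"
    proof (rule integral_mono)
      show "integrable lborel (\<lambda>x. rhs w x * u x)" using le by (intro rhs_integrable w u) auto
      show "integrable lborel (\<lambda>x. \<eta> * (u x)\<^sup>2 + K * indicator \<Omega> x)"
        using sob_square_integrable[OF u] emeasure_dom_finite by simp
      fix x
      show "rhs w x * u x \<le> \<eta> * (u x)\<^sup>2 + K * indicator \<Omega> x"
      proof (cases "x \<in> \<Omega>")
        case True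
        have "rhs w x * u x \<le> u x powr q * u x"
          using True le q_pos nonneg[of x] powr_mono2[of q "w x" "u x"]
          by (intro mult_right_mono) (auto simp: rhs_def intro: order_trans[of _ "w x powr q"])
        then show ?thesis using K[OF nonneg[of x]] True by simp
      qed (use \<eta> in \<open>simp add: rhs_def\<close>)
    qed
    also have "\<dots> = \<eta> * (\<integral>x. (u x)\<^sup>2 \<partial>lborel) + K * V"
      using sob_square_integrable[OF u] emeasure_dom_finite by (simp add: V_def)
    also have "\<dots> \<le> \<eta> * (P * form u u) + K * V"
      using P[OF u] \<eta> by (intro add_right_mono mult_left_mono) auto
    finally have "l * (\<integral>x. rhs w x * u x \<partial>lborel) \<le> l * (\<eta> * (P * form u u) + K * V)"
      using l_pos by (intro mult_left_mono) auto
    also have "\<dots> = a / 2 * form u u + l * K * V"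
      using l_pos \<open>0 < P\<close> by (simp add: \<eta>_def field_simps)
    finally have "a * form u u \<le> a / 2 * form u u + l * K * V"
      using eq u by auto
    then show ?thesis using a_pos by (simp add: field_simps)
  qed
  then show ?thesis by blast
qed

text \<open>The uniform energy bound makes the increasing iterates finite almost everywhere in the
  limit. Monotonicity also makes them Cauchy in energy, so that both sides of the equation pass to
  the limit.\<close>

theorem solution_above_subsolution:
  assumes "subsolution u0"
  shows "\<exists>u. u \<in> sob \<and> (\<forall>x. u0 x \<le> u x) \<and>
    (\<forall>\<phi>\<in>sob. a * form u \<phi> = l * (\<integral>x. rhs u x * \<phi> x \<partial>lborel))"
proof -
  have "\<exists>U. \<forall>n. subsolution (U n) \<and> (n = 0 \<longrightarrow> U n = u0) \<and> (\<forall>x. U n x \<le> U (Suc n) x) \<and>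
      (\<forall>\<phi>\<in>sob. a * form (U (Suc n)) \<phi> = l * (\<integral>x. rhs (U n) x * \<phi> x \<partial>lborel))"
  proof -
    have "\<exists>U. \<forall>n. (subsolution (U n) \<and> (n = 0 \<longrightarrow> U n = u0)) \<and> ((\<forall>x. U n x \<le> U (Suc n) x) \<and>
      (\<forall>\<phi>\<in>sob. a * form (U (Suc n)) \<phi> = l * (\<integral>x. rhs (U n) x * \<phi> x \<partial>lborel)))"
      by (rule dependent_nat_choice) (use assms monotone_step in auto)
    then show ?thesis by (simp add: conj_assoc)
  qed
  then obtain U where U: "\<And>n. subsolution (U n) \<and> (n = 0 \<longrightarrow> U n = u0) \<and> (\<forall>x. U n x \<le> U (Suc n) x) \<and>
      (\<forall>\<phi>\<in>sob. a * form (U (Suc n)) \<phi> = l * (\<integral>x. rhs (U n) x * \<phi> x \<partial>lborel))"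
    by blast
  have sub: "subsolution (U n)" and U_Suc: "U n x \<le> U (Suc n) x" for n x
    using U by auto
  have U0: "U 0 = u0" using U[of 0] by simp
  have U_eq: "a * form (U (Suc n)) \<phi> = l * (\<integral>x. rhs (U n) x * \<phi> x \<partial>lborel)" if "\<phi> \<in> sob" for n \<phi>
    using U[of n] that by blast
  have U_sob: "U n \<in> sob" and U_nonneg: "0 \<le> U n x" for n x
    using sub[of n] by (auto simp: subsolution_def)
  have [measurable]: "U n \<in> borel_measurable borel" for n using U_sob by (rule sobD)
  have U_mono: "U m x \<le> U n x" if "m \<le> n" for m n x
    using lift_Suc_mono_le[of "\<lambda>n. U n x"] U_Suc that by blast
  obtain E where E: "\<And>n. form (U (Suc n)) (U (Suc n)) \<le> E"
  proof -
    obtain E where E: "\<And>w u. w \<in> sob \<Longrightarrow> u \<in> sob \<Longrightarrow> (\<forall>x. 0 \<le> w x \<and> w x \<le> u x) \<Longrightarrow>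
      (\<forall>\<phi>\<in>sob. a * form u \<phi> = l * (\<integral>x. rhs w x * \<phi> x \<partial>lborel)) \<Longrightarrow> form u u \<le> E"
      using solution_energy_bound by blast
    have "form (U (Suc n)) (U (Suc n)) \<le> E" for n
      using U_nonneg U_Suc U_eq by (intro E[OF U_sob[of n] U_sob]) auto
    then show thesis by (rule that)
  qed
  obtain P where "0 < P" and P: "\<And>u. u \<in> sob \<Longrightarrow> (\<integral>x. (u x)\<^sup>2 \<partial>lborel) \<le> P * form u u"
    using Poincare by blast
  \<comment> \<open>The energy bound covers only iterates that solve an equation, that is indices
    \<open>Suc n\<close>; \<open>U n\<close> is handled through
    \<open>U n \<le> U (Suc n)\<close>.\<close>
  have L2: "(\<integral>\<^sup>+x. ennreal ((U n x)\<^sup>2) \<partial>lborel) \<le> ennreal (P * E)" for n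
  proof -
    have "(\<integral>\<^sup>+x. ennreal ((U n x)\<^sup>2) \<partial>lborel) \<le> (\<integral>\<^sup>+x. ennreal ((U (Suc n) x)\<^sup>2) \<partial>lborel)"
      by (intro nn_integral_mono ennreal_leI power_mono U_Suc U_nonneg)
    also have "\<dots> = ennreal (\<integral>x. (U (Suc n) x)\<^sup>2 \<partial>lborel)"
      by (intro nn_integral_eq_integral sob_square_integrable U_sob) auto
    also have "\<dots> \<le> ennreal (P * E)"
      using P[OF U_sob, of "Suc n"] mult_left_mono[OF E[of n], of P] \<open>0 < P\<close>
      by (intro ennreal_leI) linarith
    finally show ?thesis .
  qed
  have conv: "AE x in lborel. convergent (\<lambda>n. U n x)"
  proof -
    have "(\<integral>\<^sup>+x. (SUP n. ennreal ((U n x)\<^sup>2)) \<partial>lborel) = (SUP n. \<integral>\<^sup>+x. ennreal ((U n x)\<^sup>2) \<partial>lborel)"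
      by (rule nn_integral_monotone_convergence_SUP)
         (auto intro!: incseq_SucI le_funI ennreal_leI power_mono U_Suc U_nonneg)
    also have "\<dots> \<le> ennreal (P * E)" by (intro SUP_least L2)
    finally have "(\<integral>\<^sup>+x. (SUP n. ennreal ((U n x)\<^sup>2)) \<partial>lborel) \<noteq> \<infinity>"
      by (auto simp: top_unique)
    then have "AE x in lborel. (SUP n. ennreal ((U n x)\<^sup>2)) \<noteq> \<infinity>"
      by (intro nn_integral_PInf_AE) auto
    then show ?thesis
    proof eventually_elim
      fix x assume fin: "(SUP n. ennreal ((U n x)\<^sup>2)) \<noteq> \<infinity>"
      define r where "r = enn2real (SUP n. ennreal ((U n x)\<^sup>2))"
      have r: "(U n x)\<^sup>2 \<le> r" for n
      proof -
        have "ennreal ((U n x)\<^sup>2) \<le> (SUP n. ennreal ((U n x)\<^sup>2))" by (rule SUP_upper) simp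
        also have "\<dots> = ennreal r" using fin unfolding r_def by (intro ennreal_enn2real[symmetric]) (simp only: less_top infinity_ennreal_def not_False_eq_True)
        finally show ?thesis by (simp add: r_def)
      qed
      have bound: "U n x \<le> 1 + r" for n
      proof -
        have "2 * U n x \<le> 1 + (U n x)\<^sup>2"
          using zero_le_power2[of "U n x - 1"] by (simp add: power2_diff)
        then show ?thesis using r[of n] U_nonneg[of n x] by linarith
      qed
      show "convergent (\<lambda>n. U n x)"
        by (rule incseq_convergent[of "\<lambda>n. U n x" "1 + r"])
           (use bound in \<open>auto intro!: incseq_SucI U_Suc convergentI\<close>)
    qed
  qed
  \<comment> \<open>Where the iterates diverge, \<open>lim\<close> is an unspecified value. The
    maximum with \<open>u0\<close> changes nothing almost everywhere and keeps
    \<open>u0 x \<le> u x\<close> at every point, hence strict positivity there.\<close>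
  define u where "u x = max (u0 x) (lim (\<lambda>n. U n x))" for x
  have u0_eq: "u0 = U 0" by (simp add: U0)
  have [measurable]: "u \<in> borel_measurable borel" unfolding u_def[abs_def] u0_eq by measurable
  have u0_le: "u0 x \<le> u x" for x by (simp add: u_def)
  have u_nonneg: "0 \<le> u x" for x using u0_le[of x] U_nonneg[of 0 x] by (simp add: U0)
  have u_out: "u x = 0" if "x \<notin> \<Omega>" for x
    using that by (simp add: u_def u0_eq sobD(2)[OF U_sob])
  have lim: "AE x in lborel. (\<lambda>n. U n x) \<longlonglongrightarrow> u x"
    using conv
  proof eventually_elim
    fix x assume "convergent (\<lambda>n. U n x)"
    then have *: "(\<lambda>n. U n x) \<longlonglongrightarrow> lim (\<lambda>n. U n x)" by (simp add: convergent_LIMSEQ_iff)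
    then have "u0 x \<le> lim (\<lambda>n. U n x)"
      by (rule LIMSEQ_le_const) (use U_mono[of 0] U0 in auto)
    then show "(\<lambda>n. U n x) \<longlonglongrightarrow> u x" using * by (simp add: u_def)
  qed
  have upper: "AE x in lborel. \<forall>n. U n x \<le> u x"
    using lim by eventually_elim (blast intro: LIMSEQ_le_const U_mono)
  have u2: "integrable lborel (\<lambda>x. (u x)\<^sup>2)"
  proof (rule integrableI_nonneg)
    have "(\<integral>\<^sup>+x. ennreal ((u x)\<^sup>2) \<partial>lborel) = (\<integral>\<^sup>+x. liminf (\<lambda>n. ennreal ((U n x)\<^sup>2)) \<partial>lborel)"
    proof (rule nn_integral_cong_AE)
      show "AE x in lborel. ennreal ((u x)\<^sup>2) = liminf (\<lambda>n. ennreal ((U n x)\<^sup>2))"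
        using lim by eventually_elim
          (intro lim_imp_Liminf[symmetric] tendsto_ennrealI tendsto_power sequentially_bot)
    qed
    also have "\<dots> \<le> liminf (\<lambda>n. \<integral>\<^sup>+x. ennreal ((U n x)\<^sup>2) \<partial>lborel)"
      by (rule nn_integral_liminf) measurable
    also have "\<dots> \<le> ennreal (P * E)"
      by (rule Liminf_le[OF sequentially_bot]) (use L2 in auto)
    finally show "(\<integral>\<^sup>+x. ennreal ((u x)\<^sup>2) \<partial>lborel) < \<infinity>"
      by (rule le_less_trans) simp
  qed auto
  \<comment> \<open>Bounds \<open>(U n powr q - U m powr q)\<close> times the difference of the next
    iterates, for all \<open>n \<ge> m\<close> at once, by replacing \<open>U n\<close> and that
    difference with \<open>u\<close>. It tends to zero with \<open>m\<close>, dominated by a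
    quadratic expression in \<open>u\<close>.\<close>
  define gap where "gap m x = indicator \<Omega> x * (u x powr q - U m x powr q) * u x" for m x
  define e where "e m = l / a * (\<integral>x. gap m x \<partial>lborel)" for m
  have majorant: "integrable lborel (\<lambda>x. 2 * (indicator \<Omega> x * (1 + u x))\<^sup>2)"
    using one_plus_square_integrable[OF _ u2] by simp
  have gap_bound: "AE x in lborel. norm (gap m x) \<le> 2 * (indicator \<Omega> x * (1 + u x))\<^sup>2" for m
    using upper
  proof eventually_elim
    fix x assume x: "\<forall>n. U n x \<le> u x"
    show "norm (gap m x) \<le> 2 * (indicator \<Omega> x * (1 + u x))\<^sup>2"
    proof (cases "x \<in> \<Omega>")
      case True
      have "U m x powr q \<le> u x powr q" using x q_pos U_nonneg by (intro powr_mono2) auto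
      moreover have "u x powr q \<le> 1 + u x" using u_nonneg q_pos q_less_1 by (rule powr_le_one_plus)
      ultimately have "\<bar>u x powr q - U m x powr q\<bar> \<le> 1 + u x"
        using powr_ge_zero[of "U m x" q] by linarith
      then have "\<bar>u x powr q - U m x powr q\<bar> * u x \<le> (1 + u x) * (1 + u x)"
        using u_nonneg[of x] by (intro mult_mono) auto
      also have "\<dots> \<le> 2 * (1 + u x)\<^sup>2" by (simp add: power2_eq_square)
      finally show ?thesis using True u_nonneg[of x] by (simp add: gap_def abs_mult)
    qed (simp add: gap_def)
  qed
  have [measurable]: "gap m \<in> borel_measurable borel" for m unfolding gap_def[abs_def] by measurable
  have gap_int: "integrable lborel (gap m)" for m
    by (rule Bochner_Integration.integrable_bound[OF majorant])
       (use gap_bound[of m] in \<open>auto elim!: eventually_mono\<close>)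
  have e_lim: "e \<longlonglongrightarrow> 0"
  proof -
    have "(\<lambda>m. \<integral>x. gap m x \<partial>lborel) \<longlonglongrightarrow> (\<integral>x. 0 \<partial>(lborel :: 'a measure))"
    proof (rule integral_dominated_convergence[OF _ _ majorant _ gap_bound])
      show "AE x in lborel. (\<lambda>m. gap m x) \<longlonglongrightarrow> 0"
        using lim
      proof eventually_elim
        fix x assume "(\<lambda>n. U n x) \<longlonglongrightarrow> u x"
        then have "(\<lambda>n. U n x powr q) \<longlonglongrightarrow> u x powr q"
          using U_nonneg q_pos by (intro tendsto_powr2 tendsto_const) auto
        then have "(\<lambda>m. gap m x) \<longlonglongrightarrow> indicator \<Omega> x * (u x powr q - u x powr q) * u x"
          unfolding gap_def by (intro tendsto_mult tendsto_diff tendsto_const)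
        then show "(\<lambda>m. gap m x) \<longlonglongrightarrow> 0" by simp
      qed
    qed auto
    then have "(\<lambda>m. l / a * (\<integral>x. gap m x \<partial>lborel)) \<longlonglongrightarrow> l / a * 0"
      by (intro tendsto_mult_left) simp
    then show ?thesis by (simp add: e_def[abs_def])
  qed
  \<comment> \<open>The index shift reflects the scheme: the equation for \<open>U (Suc n)\<close>
    has \<open>U n\<close> on its right. Subtracting two equations and testing with the difference
    gives the energy on the left.\<close>
  have cauchy: "form (\<lambda>x. U (Suc n) x - U (Suc m) x) (\<lambda>x. U (Suc n) x - U (Suc m) x) \<le> e m"
    if "m \<le> n" for m n
  proof -
    let ?D = "\<lambda>x. U (Suc n) x - U (Suc m) x"
    have D: "?D \<in> sob" by (intro sob_diff U_sob)
    have "a * form ?D ?D = a * form (U (Suc n)) ?D - a * form (U (Suc m)) ?D"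
      by (simp only: form_diff[OF U_sob U_sob D] right_diff_distrib)
    also have "\<dots> = l * ((\<integral>x. rhs (U n) x * ?D x \<partial>lborel) - (\<integral>x. rhs (U m) x * ?D x \<partial>lborel))"
      by (simp only: U_eq[OF D] right_diff_distrib)
    also have "(\<integral>x. rhs (U n) x * ?D x \<partial>lborel) - (\<integral>x. rhs (U m) x * ?D x \<partial>lborel)
        = (\<integral>x. rhs (U n) x * ?D x - rhs (U m) x * ?D x \<partial>lborel)"
      by (intro Bochner_Integration.integral_diff[symmetric] rhs_integrable U_sob D U_nonneg)
    also have "\<dots> \<le> (\<integral>x. gap m x \<partial>lborel)"
    proof (rule integral_mono_AE)
      show "integrable lborel (\<lambda>x. rhs (U n) x * ?D x - rhs (U m) x * ?D x)"
        by (intro Bochner_Integration.integrable_diff rhs_integrable U_sob D U_nonneg)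
      show "AE x in lborel. rhs (U n) x * ?D x - rhs (U m) x * ?D x \<le> gap m x"
        using upper
      proof eventually_elim
        fix x assume x: "\<forall>n. U n x \<le> u x"
        have "U n x powr q \<le> u x powr q" "U m x powr q \<le> u x powr q"
          using x q_pos U_nonneg by (auto intro!: powr_mono2)
        moreover have "0 \<le> ?D x" using U_mono[of "Suc m" "Suc n" x] that by simp
        moreover have "?D x \<le> u x" using x U_nonneg[of "Suc m" x] spec[OF x, of "Suc n"] by linarith
        ultimately have "(U n x powr q - U m x powr q) * ?D x \<le> (u x powr q - U m x powr q) * u x"
          by (intro mult_mono) auto
        then show "rhs (U n) x * ?D x - rhs (U m) x * ?D x \<le> gap m x"
          by (simp add: rhs_def gap_def indicator_def left_diff_distrib)
      qed
    qed (rule gap_int)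
    finally have "a * form ?D ?D \<le> l * (\<integral>x. gap m x \<partial>lborel)" using l_pos by simp
    then show ?thesis using a_pos by (simp add: e_def field_simps)
  qed
  have lim_Suc: "AE x in lborel. (\<lambda>n. U (Suc n) x) \<longlonglongrightarrow> u x"
    using lim by eventually_elim (rule LIMSEQ_Suc)
  have u: "u \<in> sob"
    and close: "form (\<lambda>x. u x - U (Suc m) x) (\<lambda>x. u x - U (Suc m) x) \<le> e m" for m
    using sob_limit[where w = "\<lambda>n. U (Suc n)" and e = e, OF U_sob _ u_out lim_Suc cauchy] by auto
  have "a * form u \<phi> = l * (\<integral>x. rhs u x * \<phi> x \<partial>lborel)" if \<phi>: "\<phi> \<in> sob" for \<phi>
  proof -
    have [measurable]: "\<phi> \<in> borel_measurable borel" using \<phi> by (rule sobD)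
    have "(\<lambda>m. form (U (Suc m)) \<phi>) \<longlonglongrightarrow> form u \<phi>"
    proof -
      have "(form u \<phi> - form (U (Suc m)) \<phi>)\<^sup>2 \<le> e m * form \<phi> \<phi>" for m
      proof -
        have "(form (\<lambda>x. u x - U (Suc m) x) \<phi>)\<^sup>2 \<le> form (\<lambda>x. u x - U (Suc m) x) (\<lambda>x. u x - U (Suc m) x) * form \<phi> \<phi>"
          by (intro form_Cauchy_Schwarz sob_diff u U_sob \<phi>)
        also have "\<dots> \<le> e m * form \<phi> \<phi>" by (intro mult_right_mono close) simp
        finally show ?thesis by (simp add: form_diff u U_sob \<phi>)
      qed
      moreover have "(\<lambda>m. e m * form \<phi> \<phi>) \<longlonglongrightarrow> 0"
        using tendsto_mult_right[OF e_lim, of "form \<phi> \<phi>"] by simp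
      ultimately have "(\<lambda>m. (form u \<phi> - form (U (Suc m)) \<phi>)\<^sup>2) \<longlonglongrightarrow> 0"
        using tendsto_sandwich[of "\<lambda>_. 0" "\<lambda>m. (form u \<phi> - form (U (Suc m)) \<phi>)\<^sup>2" sequentially
            "\<lambda>m. e m * form \<phi> \<phi>" 0] by simp
      from tendsto_real_sqrt[OF this] have "(\<lambda>m. form u \<phi> - form (U (Suc m)) \<phi>) \<longlonglongrightarrow> 0"
        by (simp add: tendsto_rabs_zero_iff)
      from tendsto_diff[OF tendsto_const[of "form u \<phi>"] this] show ?thesis by simp
    qed
    then have 1: "(\<lambda>m. a * form (U (Suc m)) \<phi>) \<longlonglongrightarrow> a * form u \<phi>" by (rule tendsto_mult_left)
    have "(\<lambda>m. \<integral>x. rhs (U m) x * \<phi> x \<partial>lborel) \<longlonglongrightarrow> (\<integral>x. rhs u x * \<phi> x \<partial>lborel)"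
    proof (rule integral_dominated_convergence)
      show "integrable lborel (\<lambda>x. \<bar>indicator \<Omega> x * (1 + u x) * \<phi> x\<bar>)"
        using one_plus_square_integrable[OF _ u2]
        by (intro integrable_abs integrable_mult_sob \<phi>) auto
      show "AE x in lborel. (\<lambda>m. rhs (U m) x * \<phi> x) \<longlonglongrightarrow> rhs u x * \<phi> x"
        using lim
      proof eventually_elim
        fix x assume "(\<lambda>n. U n x) \<longlonglongrightarrow> u x"
        then have "(\<lambda>n. U n x powr q) \<longlonglongrightarrow> u x powr q"
          using U_nonneg q_pos by (intro tendsto_powr2 tendsto_const) auto
        then show "(\<lambda>m. rhs (U m) x * \<phi> x) \<longlonglongrightarrow> rhs u x * \<phi> x"
          unfolding rhs_def by (intro tendsto_mult tendsto_diff tendsto_const)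
      qed
      show "AE x in lborel. norm (rhs (U m) x * \<phi> x) \<le> \<bar>indicator \<Omega> x * (1 + u x) * \<phi> x\<bar>" for m
        using upper
      proof eventually_elim
        fix x assume x: "\<forall>n. U n x \<le> u x"
        have "\<bar>rhs (U m) x\<bar> \<le> indicator \<Omega> x * (1 + U m x)" by (rule rhs_bound[OF U_nonneg])
        also have "\<dots> \<le> indicator \<Omega> x * (1 + u x)" using x by (intro mult_left_mono) auto
        finally have "\<bar>rhs (U m) x\<bar> * \<bar>\<phi> x\<bar> \<le> indicator \<Omega> x * (1 + u x) * \<bar>\<phi> x\<bar>"
          by (rule mult_right_mono) simp
        then show "norm (rhs (U m) x * \<phi> x) \<le> \<bar>indicator \<Omega> x * (1 + u x) * \<phi> x\<bar>"
          using u_nonneg[of x] by (simp add: abs_mult)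
      qed
    qed auto
    then have 2: "(\<lambda>m. a * form (U (Suc m)) \<phi>) \<longlonglongrightarrow> l * (\<integral>x. rhs u x * \<phi> x \<partial>lborel)"
      unfolding U_eq[OF \<phi>] by (rule tendsto_mult_left)
    show ?thesis using LIMSEQ_unique[OF 1 2] .
  qed
  then show ?thesis using u u0_le by blast
qed

end

subsection \<open>Weak solutions\<close>

context frac_domain
begin

text \<open>Scaling by a factor linear in \<open>l\<close> keeps the two values of the profile bound
  in the fixed ratio of \<open>- 1\<close> to \<open>C / c\<close> relative to \<open>l\<close>,
  whereas \<open>w powr q\<close> grows without bound where \<open>v > \<delta>\<close>.\<close>

lemma positive_solution_large_parameter:
  assumes q: "0 < q" "q < 1" and a: "0 < a"
  shows "\<exists>\<Lambda>>0. \<forall>l\<ge>\<Lambda>. \<exists>u. u \<in> sob \<and> (\<forall>x\<in>\<Omega>. 0 < u x) \<and>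
    (\<forall>\<phi>\<in>sob. a * form u \<phi> = l * (\<integral>x. indicator \<Omega> x * (u x powr q - 1) * \<phi> x \<partial>lborel))"
proof -
  obtain v \<delta> c C where v: "v \<in> sob" "\<And>x. 0 \<le> v x" "\<And>x. x \<in> \<Omega> \<Longrightarrow> 0 < v x"
    and pos: "0 < \<delta>" "0 < c" "0 < C"
    and profile: "\<And>\<phi>. \<phi> \<in> sob \<Longrightarrow> (\<forall>x. 0 \<le> \<phi> x) \<Longrightarrow>
      form v \<phi> \<le> (\<integral>x. (if v x \<le> \<delta> then - c else C) * \<phi> x \<partial>lborel)"
    using subsolution_profile by blast
  \<comment> \<open>This is the condition \<open>(t * \<delta>) powr q \<ge> 1 + C / c\<close> with
    \<open>t = l / (a * c)\<close>, solved for \<open>l\<close>.\<close>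
  define \<Lambda> where "\<Lambda> = a * c * (1 + C / c) powr (1 / q) / \<delta>"
  have "0 < 1 + C / c" using pos by (simp add: add_pos_pos)
  then have \<Lambda>: "0 < \<Lambda>" using a pos by (simp add: \<Lambda>_def)
  have "\<exists>u. u \<in> sob \<and> (\<forall>x\<in>\<Omega>. 0 < u x) \<and>
    (\<forall>\<phi>\<in>sob. a * form u \<phi> = l * (\<integral>x. indicator \<Omega> x * (u x powr q - 1) * \<phi> x \<partial>lborel))"
    if l: "\<Lambda> \<le> l" for l
  proof -
    have l_pos: "0 < l" using \<Lambda> l by linarith
    interpret sublinear_problem \<Omega> s q a l
      using q a l_pos by unfold_locales
    \<comment> \<open>Normalised so that \<open>a * t * (- c) = - l\<close>, the value of the
      right-hand side at zero; this settles the region \<open>v \<le> \<delta>\<close>.\<close>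
    define t where "t = l / (a * c)"
    have t: "0 < t" using l_pos a pos by (simp add: t_def)
    have "(1 + C / c) powr (1 / q) \<le> t * \<delta>"
      using l a pos by (simp add: \<Lambda>_def t_def field_simps)
    then have "((1 + C / c) powr (1 / q)) powr q \<le> (t * \<delta>) powr q"
      using q by (intro powr_mono2) auto
    then have t_\<delta>: "1 + C / c \<le> (t * \<delta>) powr q"
      using q \<open>0 < 1 + C / c\<close> by (simp add: powr_powr)
    define w where "w x = t * v x" for x
    have w_sob: "w \<in> sob" unfolding w_def[abs_def] by (intro sob_cmult v)
    have w_nonneg: "0 \<le> w x" for x using t v by (simp add: w_def)
    have [measurable]: "v \<in> borel_measurable borel" using v(1) by (rule sobD)
    have "a * form w \<phi> \<le> l * (\<integral>x. rhs w x * \<phi> x \<partial>lborel)"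
      if \<phi>: "\<phi> \<in> sob" "\<forall>x. 0 \<le> \<phi> x" for \<phi>
    proof -
      have [measurable]: "\<phi> \<in> borel_measurable borel" using \<phi>(1) by (rule sobD)
      have G: "integrable lborel (\<lambda>x. (if v x \<le> \<delta> then - c else C) * \<phi> x)"
        by (rule Bochner_Integration.integrable_bound[OF integrable_mult_right[OF integrable_sob[OF \<phi>(1)], of "c + C"]])
           (use pos in \<open>auto simp: abs_mult intro!: mult_right_mono\<close>)
      have "a * form w \<phi> = l / c * form v \<phi>"
        unfolding w_def[abs_def] form_cmult[OF v(1) \<phi>(1)] using a pos by (simp add: t_def)
      also have "\<dots> \<le> l / c * (\<integral>x. (if v x \<le> \<delta> then - c else C) * \<phi> x \<partial>lborel)"
        using l_pos pos by (intro mult_left_mono profile \<phi>) auto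
      also have "\<dots> = l * (\<integral>x. 1 / c * ((if v x \<le> \<delta> then - c else C) * \<phi> x) \<partial>lborel)"
        by (simp del: mult_cancel_left)
      also have "\<dots> \<le> l * (\<integral>x. rhs w x * \<phi> x \<partial>lborel)"
      proof (intro mult_left_mono integral_mono)
        show "integrable lborel (\<lambda>x. 1 / c * ((if v x \<le> \<delta> then - c else C) * \<phi> x))"
          using G by (rule integrable_mult_right)
        show "integrable lborel (\<lambda>x. rhs w x * \<phi> x)"
          by (intro rhs_integrable w_sob w_nonneg \<phi>)
        fix x
        have le: "1 / c * (if v x \<le> \<delta> then - c else C) \<le> rhs w x" if "x \<in> \<Omega>"
        proof (cases "v x \<le> \<delta>")
          case True
          then show ?thesis using that pos by (simp add: rhs_def)
        next
          case False
          then have "(t * \<delta>) powr q \<le> w x powr q"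
            using t pos q by (intro powr_mono2) (auto simp: w_def)
          then show ?thesis using False that t_\<delta> by (simp add: rhs_def)
        qed
        have "1 / c * (if v x \<le> \<delta> then - c else C) * \<phi> x \<le> rhs w x * \<phi> x"
        proof (cases "x \<in> \<Omega>")
          case True
          then show ?thesis
            using le \<phi>(2) by (intro mult_right_mono) auto
        qed (simp add: sobD(2)[OF \<phi>(1)])
        then show "1 / c * ((if v x \<le> \<delta> then - c else C) * \<phi> x) \<le> rhs w x * \<phi> x"
          by (simp only: mult.assoc)
      qed (use l_pos in auto)
      finally show ?thesis .
    qed
    then have "subsolution w"
      using w_sob w_nonneg by (simp add: subsolution_def)
    then obtain u where u: "u \<in> sob" "\<And>x. w x \<le> u x"
      "\<And>\<phi>. \<phi> \<in> sob \<Longrightarrow> a * form u \<phi> = l * (\<integral>x. rhs u x * \<phi> x \<partial>lborel)"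
      using solution_above_subsolution by blast
    have "0 < u x" if "x \<in> \<Omega>" for x
      using u(2)[of x] v(3)[OF that] t by (auto simp: w_def intro: less_le_trans[of _ "t * v x"])
    then show ?thesis using u unfolding rhs_def by blast
  qed
  then show ?thesis using \<Lambda> by blast
qed

text \<open>The partial derivatives are continuous and vanish off a compact set, so they are
  bounded. The mean value inequality then gives a global Lipschitz constant, and
  \<open>lipschitz_in_sob\<close> applies.\<close>

lemma test_functions_sob:
  assumes "\<phi> \<in> test_functions \<Omega>"
  shows "\<phi> \<in> sob"
proof -
  define K where "K = closure {x. \<phi> x \<noteq> 0}"
  have K: "compact K" "K \<subseteq> \<Omega>" and td: "times_differentiable (Suc 0) \<phi>"
    using assms unfolding test_functions_def K_def by blast+
  have zero: "\<phi> x = 0" if "x \<notin> K" for x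
    using that closure_subset[of "{x. \<phi> x \<noteq> 0}"] by (auto simp: K_def)
  have diff: "(\<phi> has_derivative frechet_derivative \<phi> (at x)) (at x)" for x
    using td by (simp flip: frechet_derivative_works)
  have cont: "continuous_on UNIV (\<lambda>x. frechet_derivative \<phi> (at x) i)" for i
    using td by simp
  have cont_\<phi>: "continuous_on UNIV \<phi>"
    using diff by (intro has_derivative_continuous_on) auto
  have D0: "frechet_derivative \<phi> (at x) = (\<lambda>h. 0)" if "x \<notin> K" for x
  proof -
    have "(\<phi> has_derivative (\<lambda>h. 0)) (at x)"
      using has_derivative_const[of 0 "at x"]
      by (rule has_derivative_transform_within_open[where s = "- K"])
         (use that zero K in \<open>auto simp: compact_imp_closed\<close>)
    then show ?thesis using diff has_derivative_unique by blast
  qed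
  have bound: "\<exists>B. \<forall>x. \<bar>f x\<bar> \<le> B" if "continuous_on UNIV f" "\<And>x. x \<notin> K \<Longrightarrow> f x = 0" for f :: "'a \<Rightarrow> real"
  proof -
    have "compact (f ` K)"
      using that K by (intro compact_continuous_image) (auto intro: continuous_on_subset)
    then obtain B where "0 < B" "\<And>x. x \<in> K \<Longrightarrow> \<bar>f x\<bar> \<le> B"
      by (auto dest!: compact_imp_bounded simp: bounded_pos)
    then show ?thesis using that(2) by (intro exI[of _ B] allI) (metis abs_zero less_imp_le)
  qed
  have "\<exists>B. \<forall>x. \<bar>frechet_derivative \<phi> (at x) i\<bar> \<le> B" for i
    by (intro bound cont) (simp add: D0)
  then obtain B where B: "\<And>i x. \<bar>frechet_derivative \<phi> (at x) i\<bar> \<le> B i" by metis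
  define L where "L = (\<Sum>i\<in>Basis. B i)"
  have onorm: "onorm (frechet_derivative \<phi> (at x)) \<le> L" for x
  proof (rule onorm_le)
    fix h :: 'a
    have lin: "linear (frechet_derivative \<phi> (at x))"
      using diff[of x] by (rule has_derivative_linear)
    have "frechet_derivative \<phi> (at x) h = frechet_derivative \<phi> (at x) (\<Sum>i\<in>Basis. (h \<bullet> i) *\<^sub>R i)"
      by (simp add: euclidean_representation)
    also have "\<dots> = (\<Sum>i\<in>Basis. (h \<bullet> i) * frechet_derivative \<phi> (at x) i)"
      by (simp add: linear_sum[OF lin] linear_cmul[OF lin])
    finally have "norm (frechet_derivative \<phi> (at x) h) \<le> (\<Sum>i\<in>Basis. \<bar>(h \<bullet> i) * frechet_derivative \<phi> (at x) i\<bar>)"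
      by (simp add: sum_abs)
    also have "\<dots> \<le> (\<Sum>i\<in>Basis. norm h * B i)"
      using B by (auto intro!: sum_mono mult_mono simp: abs_mult Basis_le_norm)
    finally show "norm (frechet_derivative \<phi> (at x) h) \<le> L * norm h"
      by (simp add: L_def sum_distrib_left mult.commute)
  qed
  have "L-lipschitz_on UNIV \<phi>"
  proof (rule lipschitz_onI)
    fix x y
    show "dist (\<phi> x) (\<phi> y) \<le> L * dist x y"
      unfolding dist_norm
      by (rule differentiable_bound[of UNIV]) (use diff onorm in auto)
    show "0 \<le> L" unfolding L_def using B[of 0] by (intro sum_nonneg) (meson abs_ge_zero order_trans)
  qed
  moreover obtain M where "\<And>x. \<bar>\<phi> x\<bar> \<le> M"
    using bound[OF cont_\<phi>] zero by blast
  ultimately show ?thesis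
    using zero K(2) by (intro lipschitz_in_sob) auto
qed

section \<open>Passage from the form to the integrals over \<open>Q_set\<close> and to
  \<open>Xs0\<close>\<close>

lemma quotient_kernel:
  "y / norm (x1 - x2) powr (real DIM('a) + 2 * s) = frac_kernel s (x1 - x2 :: 'a) * y"
  by (simp add: frac_kernel_def)

text \<open>Off \<open>Q_set \<Omega>\<close> both points lie outside \<Omega> and the integrand is
  zero, so restricting to this set changes nothing. The rest is the passage from Borel to completed
  Lebesgue measure on the product.\<close>

lemma set_integral_Q:
  assumes u: "u \<in> sob" and v: "v \<in> sob"
  shows "set_integrable lebesgue (Q_set \<Omega>)
      (\<lambda>(x, y). (u x - u y) * (v x - v y) / norm (x - y) powr (real DIM('a) + 2 * s))" (is ?int)
    and "set_lebesgue_integral lebesgue (Q_set \<Omega>)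
      (\<lambda>(x, y). (u x - u y) * (v x - v y) / norm (x - y) powr (real DIM('a) + 2 * s)) = form u v" (is ?eq)
proof -
  have [measurable]: "u \<in> borel_measurable borel" "v \<in> borel_measurable borel"
    using u v by (auto simp: sob_def)
  let ?f = "\<lambda>p. frac_kernel s (fst p - snd p) * (delta u p * delta v p)"
  have eq: "indicator (Q_set \<Omega>) p *\<^sub>R (case p of (x, y) \<Rightarrow>
      (u x - u y) * (v x - v y) / norm (x - y) powr (real DIM('a) + 2 * s)) = ?f p" for p
    using sobD(2)[OF u] sobD(2)[OF v]
    by (cases p; cases "p \<in> Q_set \<Omega>") (auto simp: Q_set_def delta_def quotient_kernel)
  have meas: "?f \<in> borel_measurable lborel"
    unfolding lborel_prod[symmetric] by measurable
  have "integrable (lborel \<Otimes>\<^sub>M lborel) ?f"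
    using form_integrable[OF u v] unfolding pair_meas_def
    by (subst (asm) integrable_density) auto
  then have int: "integrable lborel ?f" by (simp only: lborel_prod)
  show ?int
    unfolding set_integrable_def eq using int meas by (simp add: integrable_completion)
  have "form u v = integral\<^sup>L (lborel \<Otimes>\<^sub>M lborel) ?f"
    unfolding form_def pair_meas_def by (subst integral_density) auto
  then have "form u v = integral\<^sup>L lborel ?f" by (simp only: lborel_prod)
  then show ?eq
    unfolding set_lebesgue_integral_def eq using meas by (simp add: integral_completion)
qed

lemma sob_Xs0:
  assumes u: "u \<in> sob"
  shows "u \<in> Xs0 s \<Omega>"
proof -
  have [measurable]: "u \<in> borel_measurable borel" using u by (rule sobD)
  have "set_integrable lebesgue \<Omega> (\<lambda>x. (u x)\<^sup>2)"
  proof -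
    have "integrable lborel (\<lambda>x. indicator \<Omega> x *\<^sub>R (u x)\<^sup>2)"
      by (rule integrable_mult_indicator) (use sob_square_integrable[OF u] in auto)
    then show ?thesis by (simp add: set_integrable_def integrable_completion)
  qed
  moreover have "set_integrable lebesgue (Q_set \<Omega>)
      (\<lambda>(x, y). \<bar>u x - u y\<bar>\<^sup>2 / norm (x - y) powr (real DIM('a) + 2 * s))"
    using set_integral_Q(1)[OF u u] by (simp add: power2_eq_square)
  ultimately show ?thesis
    using sobD(2)[OF u] by (auto simp: Xs0_def Xs_def measurable_completion)
qed

end

theorem theorem1p1:
  fixes \<Omega> :: "(real ^ 'n) set" and s q :: real
  assumes "0 < s" and "s < 1" and "real CARD('n) > 2 * s"
    and "0 < q" and "q < 1"
    and "bounded_C11_domain \<Omega>"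
  shows "\<exists>lam0::real. lam0 > 0 \<and>
           (\<forall>lam>lam0. \<exists>u. positive_weak_solution s q lam \<Omega> u) \<and>
           (\<exists>u. nonnegative_weak_solution s q lam0 \<Omega> u)"
proof -
  interpret frac_domain \<Omega> s
    using assms by unfold_locales (auto simp: bounded_C11_domain_def)
  have const: "0 < frac_const DIM(real ^ 'n) s"
    unfolding frac_const_def using assms
    by (intro divide_pos_pos mult_pos_pos Gamma_real_pos) auto
  obtain \<Lambda> where "0 < \<Lambda>" and \<Lambda>: "\<And>l. \<Lambda> \<le> l \<Longrightarrow> \<exists>u. u \<in> sob \<and> (\<forall>x\<in>\<Omega>. 0 < u x) \<and>
    (\<forall>\<phi>\<in>sob. frac_const DIM(real ^ 'n) s * form u \<phi>
      = l * (\<integral>x. indicator \<Omega> x * (u x powr q - 1) * \<phi> x \<partial>lborel))"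
    using positive_solution_large_parameter[OF \<open>0 < q\<close> \<open>q < 1\<close> const] by blast
  have sol: "\<exists>u. positive_weak_solution s q l \<Omega> u" if l: "\<Lambda> \<le> l" for l
  proof -
    obtain u where u: "u \<in> sob" "\<forall>x\<in>\<Omega>. 0 < u x"
      and eq: "\<And>\<phi>. \<phi> \<in> sob \<Longrightarrow> frac_const DIM(real ^ 'n) s * form u \<phi>
        = l * (\<integral>x. indicator \<Omega> x * (u x powr q - 1) * \<phi> x \<partial>lborel)"
      using \<Lambda>[OF l] by blast
    have [measurable]: "u \<in> borel_measurable borel" using u(1) by (rule sobD)
    have "energy_form s \<Omega> u \<phi> = l * (LINT x:\<Omega>|lebesgue. (u x powr q - 1) * \<phi> x)"
      if "\<phi> \<in> test_functions \<Omega>" for \<phi>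
    proof -
      have \<phi>: "\<phi> \<in> sob" using that by (rule test_functions_sob)
      have [measurable]: "\<phi> \<in> borel_measurable borel" using \<phi> by (rule sobD)
      have "(LINT x:\<Omega>|lebesgue. (u x powr q - 1) * \<phi> x)
          = (\<integral>x. indicator \<Omega> x * (u x powr q - 1) * \<phi> x \<partial>lborel)"
        by (simp add: set_lebesgue_integral_def integral_completion mult.assoc)
      from eq[OF \<phi>, folded this] show ?thesis
        unfolding energy_form_def set_integral_Q(2)[OF u(1) \<phi>] .
    qed
    then show ?thesis
      using u sob_Xs0 unfolding positive_weak_solution_def satisfies_weak_form_def by blast
  qed
  \<comment> \<open>At the threshold the construction even gives a strictly positive solution; its
    sign condition is only weakened here.\<close>
  have "\<exists>u. nonnegative_weak_solution s q \<Lambda> \<Omega> u"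
    using sol[of \<Lambda>] unfolding positive_weak_solution_def nonnegative_weak_solution_def
    by (meson less_imp_le order_refl)
  then show ?thesis
    using \<open>0 < \<Lambda>\<close> sol by (intro exI[of _ \<Lambda>]) (auto simp: less_imp_le)
qed

end
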